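(* Let $0<\tau<1$ and $C$ be real constants, and let $\mathcal{T}$ be any set of primes with $$\sum_{\substack{p\le x\\ p\in\mathcal{T}}}\frac{\log p}{p}=\tau\log x+C+o(1)\qquad(x\to\infty).$$ Let $\mathcal{Q}(\mathcal{T})=\{n\in\mathbb{N}: p\mid n\Rightarrow p\in\mathcal{T}\}$, where $p$ denotes primes. Then there do not exist sets $\mathcal{A},\mathcal{B},\mathcal{C}$ of positive integers, with at least two elements each, such that $\mathcal{Q}(\mathcal{T})\sim\mathcal{A}+\mathcal{B}+\mathcal{C}$.
   Context: For sets of positive integers, $\mathcal{A}+\mathcal{B}+\mathcal{C}:=\{a+b+c: a\in\mathcal{A}, b\in\mathcal{B}, c\in\mathcal{C}\}$. For sets $\mathcal{X},\mathcal{S}$ of positive integers we write $\mathcal{S}\sim\mathcal{X}$ if there is some $x_0$ with $\mathcal{X}\cap[x_0,\infty)=\mathcal{S}\cap[x_0,\infty)$. *)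

theory Defs
  imports
    Complex_Main
    "HOL-Computational_Algebra.Primes"
    "HOL-Library.Landau_Symbols"
    "HOL-Library.Set_Algebras"
begin

text \<open>
  Sets of positive integers are sets of naturals that do not contain 0.
  Sumsets are the pointwise sums of \<^theory>\<open>HOL-Library.Set_Algebras\<close>.
\<close>

definition \<Q> :: "nat set \<Rightarrow> nat set" where
  "\<Q> T = {n. n > 0 \<and> (\<forall>p. prime p \<longrightarrow> p dvd n \<longrightarrow> p \<in> T)}"

definition eventually_same :: "nat set \<Rightarrow> nat set \<Rightarrow> bool"  (infix "\<sim>\<^sub>\<infinity>" 50) where
  "S \<sim>\<^sub>\<infinity> X \<longleftrightarrow> (\<exists>x\<^sub>0. X \<inter> {x\<^sub>0..} = S \<inter> {x\<^sub>0..})"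

text \<open>The cardinality function is 0 on infinite sets, hence the explicit elements.\<close>

definition at_least_two :: "nat set \<Rightarrow> bool" where
  "at_least_two A \<longleftrightarrow> (\<exists>x\<in>A. \<exists>y\<in>A. x \<noteq> y)"

end

theory Submission
  imports
    Defs
    "HOL-Number_Theory.Cong"
    "HOL-Number_Theory.Prime_Powers"
    "HOL-Real_Asymp.Real_Asymp"
    "HOL-Analysis.Convex"
begin

text \<open>
  Suppose $Q(T) \sim U + V$ and let $R$ be the set of primes outside $T$, which has logarithmic
  density $1 - \tau$. The elements of $U$ avoid the negatives of all residues of $V$ modulo every
  $p \in R$. Sieving by $k$ elements of $V$ and comparing with a lower bound for $Q(T)$ shows that
  $V$ is infinite and then that it has at least $(\log x)^r$ elements up to $x$ for every $r$.
  By Gallagher's larger sieve such a set occupies many residues modulo most primes up to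
  $(\log x)^r$, and sieving by all of them yields at most $x^{13/20}$ elements of $U$ up to $x$.
  For $Q(T) \sim A + B + C$ this bounds all of $A + B$, $B + C$, $A + C$, while
  $|A + B + C|^2 \le |A + B| |B + C| |A + C|$ would then give $Q(T)$ at most $O(x^{39/40})$
  elements up to $x$, which is too few.
\<close>

section \<open>A sieve for many residue classes\<close>

text \<open>Three summands are essential to the contradiction. The sieve level N^(2/5) cannot push
  the bound for a summand below about N^(3/5), and the product of two such bounds exceeds N. For
  three pair sums any exponent below 2/3 is enough, since the cardinality inequality turns an
  exponent e into 3e/2. This slack is what allows an elementary sieve in place of the sharp large
  sieve inequality.

  Sieving by a fixed number of elements saves only powers of log N; saving a power of N needs a
  number of residues that grows with p, hence the detour through the larger sieve. The second
  element of V is what starts the process: one sieving element gives back only the order of Q(T),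
  the next one gains about (log N)^(1 - \<tau>).

  Products of primes are always taken over sets of exactly m primes. The weights are then elementary
  symmetric sums, bounded below by the m-th power of a slightly reduced prime sum over m!, and the
  level is y^m if the primes are at most y. The same device bounds Q(T) from below, where losing an
  arbitrarily small power of log N is harmless.\<close>

lemma periodic_mult:
  fixes f :: "int \<Rightarrow> 'a" and M :: nat
  assumes "\<And>n. f (n + int M) = f n"
  shows "f (n + int M * int k) = f n"
proof (induction k)
  case (Suc k)
  have "f (n + int M * int (Suc k)) = f ((n + int M * int k) + int M)"
    by (simp add: algebra_simps)
  then show ?case using Suc assms by simp
qed simp

lemma periodic_dvd:
  fixes f :: "int \<Rightarrow> 'a" and M :: nat
  assumes "\<And>n. f (n + int M) = f n" and "M dvd L"
  shows "f (n + int L) = f n"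
  using periodic_mult[of f M, OF assms(1)] assms(2) by (auto elim!: dvdE)

lemma periodic_mod:
  fixes f :: "int \<Rightarrow> 'a" and M :: nat
  assumes "\<And>n. f (n + int M) = f n"
  shows "f (int (k mod M)) = f (int k)"
proof -
  have "f (int k) = f (int (k mod M) + int M * int (k div M))"
    by (metis mod_mult_div_eq of_nat_add of_nat_mult)
  then show ?thesis using periodic_mult[of f M, OF assms] by simp
qed

lemma sum_period_shift:
  fixes f :: "int \<Rightarrow> 'a::comm_ring" and M :: nat
  assumes per: "\<And>n. f (n + int M) = f n"
  shows "(\<Sum>i<M. f (a + int i)) = (\<Sum>i<M. f (int i))"
proof -
  have step: "(\<Sum>i<M. f (b + 1 + int i)) = (\<Sum>i<M. f (b + int i))" for b
  proof -
    have "(\<Sum>i<Suc M. f (b + int i)) = f b + (\<Sum>i<M. f (b + 1 + int i))"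
      by (subst sum.lessThan_Suc_shift) (simp add: add_ac)
    then show ?thesis using per[of b] by (simp add: add_ac)
  qed
  show ?thesis
  proof (induction a rule: int_induct[where k = 0])
    case (step1 i)
    then show ?case using step[of i] by simp
  next
    case (step2 i)
    then show ?case using step[of "i - 1"] by simp
  qed simp
qed

lemma sum_lessThan_add:
  fixes f :: "nat \<Rightarrow> 'a::comm_monoid_add"
  shows "(\<Sum>i<m + n. f i) = (\<Sum>i<m. f i) + (\<Sum>i<n. f (m + i))"
  by (induction n) (simp_all add: add_ac)

lemma sum_periods:
  fixes f :: "int \<Rightarrow> real" and M :: nat
  assumes per: "\<And>n. f (n + int M) = f n"
  shows "(\<Sum>i<k * M + r. f (a + int i)) = real k * (\<Sum>i<M. f (int i)) + (\<Sum>i<r. f (a + int i))"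
proof (induction k)
  case (Suc k)
  have "(\<Sum>i<Suc k * M + r. f (a + int i)) = (\<Sum>i<M + (k * M + r). f (a + int i))"
    by (simp add: add_ac)
  also have "\<dots> = (\<Sum>i<M. f (a + int i)) + (\<Sum>i<k * M + r. f (a + int i + int M))"
    by (subst sum_lessThan_add) (simp add: add_ac)
  also have "\<dots> = (\<Sum>i<M. f (int i)) + (\<Sum>i<k * M + r. f (a + int i))"
    by (simp add: per sum_period_shift[of f M, OF per])
  finally show ?case using Suc by (simp add: algebra_simps)
qed simp

lemma sum_interval_le_periods:
  fixes f :: "int \<Rightarrow> real" and M :: nat
  assumes per: "\<And>n. f (n + int M) = f n" and nonneg: "\<And>n. f n \<ge> 0" and "M > 0"
  shows "(\<Sum>i<K. f (a + int i)) \<le> (real K / real M + 1) * (\<Sum>i<M. f (int i))"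
proof -
  have "(\<Sum>i<K. f (a + int i)) = (\<Sum>i<(K div M) * M + K mod M. f (a + int i))" by simp
  also have "\<dots> = real (K div M) * (\<Sum>i<M. f (int i)) + (\<Sum>i<K mod M. f (a + int i))"
    by (rule sum_periods[of f M, OF per])
  also have "(\<Sum>i<K mod M. f (a + int i)) \<le> (\<Sum>i<M. f (a + int i))"
    using \<open>M > 0\<close> nonneg by (intro sum_mono2) (auto intro: less_trans[OF _ mod_less_divisor])
  also have "\<dots> = (\<Sum>i<M. f (int i))" by (rule sum_period_shift[of f M, OF per])
  also have "real (K div M) * (\<Sum>i<M. f (int i)) + (\<Sum>i<M. f (int i))
      = (real (K div M) + 1) * (\<Sum>i<M. f (int i))" by (simp add: algebra_simps)
  also have "\<dots> \<le> (real K / real M + 1) * (\<Sum>i<M. f (int i))"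
    using nonneg by (intro mult_right_mono add_right_mono of_nat_div_le_of_nat sum_nonneg)
  finally show ?thesis by simp
qed

text \<open>Complete periods contribute zero, so only an incomplete one of fewer than M terms is
  left. The bound therefore does not grow with \<open>K\<close>.\<close>

lemma abs_sum_interval_mean_zero:
  fixes f :: "int \<Rightarrow> real" and M :: nat
  assumes per: "\<And>n. f (n + int M) = f n" and zero: "(\<Sum>i<M. f (int i)) = 0" and "M > 0"
  shows "\<bar>\<Sum>i<K. f (a + int i)\<bar> \<le> (\<Sum>i<M. \<bar>f (int i)\<bar>)"
proof -
  have "(\<Sum>i<K. f (a + int i)) = (\<Sum>i<(K div M) * M + K mod M. f (a + int i))" by simp
  also have "\<dots> = (\<Sum>i<K mod M. f (a + int i))"
    unfolding sum_periods[of f M, OF per] by (simp add: zero)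
  finally have "\<bar>\<Sum>i<K. f (a + int i)\<bar> \<le> (\<Sum>i<K mod M. \<bar>f (a + int i)\<bar>)"
    by (simp add: sum_abs)
  also have "\<dots> \<le> (\<Sum>i<M. \<bar>f (a + int i)\<bar>)"
    using \<open>M > 0\<close> by (intro sum_mono2) (auto intro: less_trans[OF _ mod_less_divisor])
  also have "\<dots> = (\<Sum>i<M. \<bar>f (int i)\<bar>)"
    by (rule sum_period_shift[of "\<lambda>n. \<bar>f n\<bar>"]) (simp add: per)
  finally show ?thesis .
qed

text \<open>
  Averaging over a second interval makes the bound independent of its length: the inner sums are
  again periodic with mean zero.
\<close>

lemma abs_double_sum_mean_zero:
  fixes f :: "int \<Rightarrow> real" and M :: nat
  assumes per: "\<And>n. f (n + int M) = f n" and zero: "(\<Sum>i<M. f (int i)) = 0" and "M > 0"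
  shows "\<bar>\<Sum>i<K. \<Sum>j<K. f (a + int i + int j)\<bar> \<le> real M * (\<Sum>i<M. \<bar>f (int i)\<bar>)"
proof -
  define G where "G c = (\<Sum>j<K. f (c + int j))" for c
  have perG: "G (n + int M) = G n" for n
  proof -
    have "f (n + int M + int j) = f (n + int j)" for j
      using per[of "n + int j"] by (simp add: add_ac)
    then show ?thesis by (simp add: G_def)
  qed
  have "(\<Sum>i<M. G (int i)) = (\<Sum>j<K. \<Sum>i<M. f (int j + int i))"
    unfolding G_def by (subst sum.swap) (simp add: add_ac)
  also have "\<dots> = 0" by (simp add: sum_period_shift[of f M, OF per] zero)
  finally have zeroG: "(\<Sum>i<M. G (int i)) = 0" .
  have "\<bar>\<Sum>i<K. \<Sum>j<K. f (a + int i + int j)\<bar> = \<bar>\<Sum>i<K. G (a + int i)\<bar>"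
    by (simp add: G_def)
  also have "\<dots> \<le> (\<Sum>i<M. \<bar>G (int i)\<bar>)"
    by (rule abs_sum_interval_mean_zero[OF perG zeroG \<open>M > 0\<close>])
  also have "\<dots> \<le> (\<Sum>i<M. \<Sum>i<M. \<bar>f (int i)\<bar>)"
    unfolding G_def by (intro sum_mono abs_sum_interval_mean_zero per zero \<open>M > 0\<close>)
  finally show ?thesis by simp
qed

text \<open>Chinese remainder theorem in summed form: in i = a + m * b the factor \<open>f\<close>
  sees only a, and for fixed a the map b \<mapsto> (a + m * b) mod n permutes the residues modulo
  n.\<close>

lemma sum_coprime_periods:
  fixes f g :: "int \<Rightarrow> real" and m n :: nat
  assumes f: "\<And>k. f (k + int m) = f k" and g: "\<And>k. g (k + int n) = g k"
    and "coprime m n" and "m > 0" and "n > 0"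
  shows "(\<Sum>i<m * n. f (int i) * g (int i)) = (\<Sum>i<m. f (int i)) * (\<Sum>i<n. g (int i))"
proof -
  have bij: "bij_betw (\<lambda>b. (a + m * b) mod n) {..<n} {..<n}" for a
  proof -
    have inj: "inj_on (\<lambda>b. (a + m * b) mod n) {..<n}"
    proof (rule inj_onI)
      fix x y assume xy: "x \<in> {..<n}" "y \<in> {..<n}" "(a + m * x) mod n = (a + m * y) mod n"
      from xy(3) have "[a + m * x = a + m * y] (mod n)" unfolding unique_euclidean_semiring_class.cong_def .
      then have "[m * x = m * y] (mod n)" by (rule cong_add_lcancel_nat[THEN iffD1])
      then have "[x = y] (mod n)" by (rule cong_mult_lcancel_nat[OF \<open>coprime m n\<close>, THEN iffD1])
      then show "x = y" using xy(1,2) cong_less_modulus_unique_nat by blast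
    qed
    moreover have "(\<lambda>b. (a + m * b) mod n) ` {..<n} = {..<n}"
      using \<open>n > 0\<close> inj by (intro card_subset_eq) (use inj in \<open>auto simp: card_image\<close>)
    ultimately show ?thesis by (simp add: bij_betw_def)
  qed
  have inner: "(\<Sum>b<n. g (int (a + m * b))) = (\<Sum>i<n. g (int i))" for a
  proof -
    have "(\<Sum>b<n. g (int (a + m * b))) = (\<Sum>b<n. g (int ((a + m * b) mod n)))"
      by (simp only: periodic_mod[of g n, OF g])
    also have "\<dots> = (\<Sum>i<n. g (int i))"
      by (rule sum.reindex_bij_betw[OF bij])
    finally show ?thesis .
  qed
  have "(\<Sum>i<m * n. f (int i) * g (int i)) = (\<Sum>i<n * m. f (int i) * g (int i))"
    by (simp add: mult.commute)
  also have "\<dots> = (\<Sum>b<n. \<Sum>i\<in>{b * m..<b * m + m}. f (int i) * g (int i))"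
    by (rule sum.nat_group[symmetric])
  also have "\<dots> = (\<Sum>b<n. \<Sum>a<m. f (int (a + m * b)) * g (int (a + m * b)))"
  proof (rule sum.cong[OF refl])
    fix b
    show "(\<Sum>i\<in>{b * m..<b * m + m}. f (int i) * g (int i)) =
        (\<Sum>a<m. f (int (a + m * b)) * g (int (a + m * b)))"
      using sum.shift_bounds_nat_ivl[of "\<lambda>i. f (int i) * g (int i)" 0 "b * m" m]
      by (simp add: atLeast0LessThan mult.commute add.commute)
  qed
  also have "\<dots> = (\<Sum>b<n. \<Sum>a<m. f (int a) * g (int (a + m * b)))"
    using periodic_mult[of f m, OF f] by simp
  also have "\<dots> = (\<Sum>a<m. f (int a) * (\<Sum>b<n. g (int (a + m * b))))"
    by (subst sum.swap) (simp add: sum_distrib_left)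
  also have "\<dots> = (\<Sum>i<m. f (int i)) * (\<Sum>i<n. g (int i))"
    by (simp only: inner sum_distrib_right)
  finally show ?thesis .
qed

lemma prod_primes_periodic:
  fixes \<phi> :: "nat \<Rightarrow> int \<Rightarrow> real"
  assumes "finite X" and "\<And>p k. p \<in> X \<Longrightarrow> \<phi> p (k + int p) = \<phi> p k"
  shows "(\<Prod>p\<in>X. \<phi> p (k + int (\<Prod>X))) = (\<Prod>p\<in>X. \<phi> p k)"
proof (rule prod.cong[OF refl])
  fix p assume p: "p \<in> X"
  have "p dvd \<Prod>X" using dvd_prodI[OF assms(1) p, of "\<lambda>x. x"] .
  then show "\<phi> p (k + int (\<Prod>X)) = \<phi> p k"
    by (rule periodic_dvd[of "\<phi> p" p, OF assms(2)[OF p]])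
qed

lemma sum_prod_primes:
  fixes \<phi> :: "nat \<Rightarrow> int \<Rightarrow> real"
  assumes "finite X" and "\<And>p. p \<in> X \<Longrightarrow> prime p"
    and "\<And>p k. p \<in> X \<Longrightarrow> \<phi> p (k + int p) = \<phi> p k"
  shows "(\<Sum>i<\<Prod>X. \<Prod>p\<in>X. \<phi> p (int i)) = (\<Prod>p\<in>X. \<Sum>i<p. \<phi> p (int i))"
  using assms
proof (induction X rule: finite_induct)
  case (insert q X)
  have cop: "coprime q (\<Prod>X)"
    using insert by (intro prod_coprime_right) (metis insertCI primes_coprime)
  have "(\<Sum>i<\<Prod>(insert q X). \<Prod>p\<in>insert q X. \<phi> p (int i)) =
      (\<Sum>i<q * \<Prod>X. \<phi> q (int i) * (\<Prod>p\<in>X. \<phi> p (int i)))"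
    using insert.hyps by simp
  also have "\<dots> = (\<Sum>i<q. \<phi> q (int i)) * (\<Sum>i<\<Prod>X. \<Prod>p\<in>X. \<phi> p (int i))"
  proof (rule sum_coprime_periods)
    show "\<phi> q (k + int q) = \<phi> q k" for k using insert.prems by simp
    show "(\<Prod>p\<in>X. \<phi> p (k + int (\<Prod>X))) = (\<Prod>p\<in>X. \<phi> p k)" for k
      using insert by (intro prod_primes_periodic) auto
    show "q > 0" using insert.prems by (simp add: prime_gt_0_nat)
    show "\<Prod>X > 0" using insert.prems by (intro prod_pos) (auto intro: prime_gt_0_nat)
  qed (rule cop)
  also have "(\<Sum>i<\<Prod>X. \<Prod>p\<in>X. \<phi> p (int i)) = (\<Prod>p\<in>X. \<Sum>i<p. \<phi> p (int i))"
    using insert by blast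
  finally show ?case using insert.hyps by simp
qed simp

text \<open>A set of primes is recovered as the prime divisors of its product. This bounds the
  number of sets with product at most Q by Q, and turns sums over sets of primes into sums over
  distinct integers.\<close>

lemma inj_on_prod_prime_sets:
  assumes "\<And>X. X \<in> \<X> \<Longrightarrow> finite X \<and> (\<forall>p\<in>X. prime p)"
  shows "inj_on (\<lambda>X. \<Prod>X :: nat) \<X>"
proof (rule inj_onI)
  have rec: "X = {p. prime p \<and> p dvd \<Prod>X}" if "X \<in> \<X>" for X
  proof -
    have X: "finite X" "\<forall>p\<in>X. prime p" using assms[OF that] by auto
    have "p \<in> X \<longleftrightarrow> prime p \<and> p dvd \<Prod>X" for p
    proof
      assume "p \<in> X"
      then show "prime p \<and> p dvd \<Prod>X" using X dvd_prodI[of X p "\<lambda>x. x"] by blast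
    next
      assume p: "prime p \<and> p dvd \<Prod>X"
      then obtain q where "q \<in> X" "p dvd q" using prime_dvd_prod_iff[of X p "\<lambda>x. x"] X(1) by blast
      then show "p \<in> X" using X(2) p primes_dvd_imp_eq by metis
    qed
    then show ?thesis by blast
  qed
  fix X Y assume XY: "X \<in> \<X>" "Y \<in> \<X>" "\<Prod>X = \<Prod>Y"
  show "X = Y" by (subst rec[OF XY(1)], subst rec[OF XY(2)]) (simp only: XY(3))
qed

text \<open>
  An upper bound sieve of large sieve type, with the level $N^{2/5}$ in place of $N^{1/2}$.
  For each prime $p$, the function $g_p$ below has mean zero and equals 1 off the forbidden
  classes. A weighted sum $F$ of products of the $g_p$ thus takes the same large value at all sifted
  integers, while distinct products are nearly orthogonal, so that $\sum F^2$ is small.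
\<close>

lemma elementary_sieve:
  fixes Z :: "int set" and N Q :: nat and \<X> :: "nat set set" and \<Omega> :: "nat \<Rightarrow> nat set"
  assumes "finite \<X>" and \<X>: "\<And>X. X \<in> \<X> \<Longrightarrow> finite X \<and> (\<forall>p\<in>X. prime p)"
    and \<Omega>: "\<And>X p. X \<in> \<X> \<Longrightarrow> p \<in> X \<Longrightarrow> \<Omega> p \<subseteq> {..<p} \<and> 0 < card (\<Omega> p) \<and> card (\<Omega> p) < p"
    and Z: "Z \<subseteq> {1..int N}"
    and sift: "\<And>X p z. X \<in> \<X> \<Longrightarrow> p \<in> X \<Longrightarrow> z \<in> Z \<Longrightarrow> nat (z mod int p) \<notin> \<Omega> p"
    and Q: "\<And>X. X \<in> \<X> \<Longrightarrow> \<Prod>X \<le> Q" "Q ^ 5 \<le> N ^ 2" and "N > 0"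
  shows "real (card Z) * (\<Sum>X\<in>\<X>. \<Prod>p\<in>X. real (card (\<Omega> p)) / (real p - real (card (\<Omega> p)))) \<le> 7 * real N"
proof -
  define h where "h p = real (card (\<Omega> p)) / (real p - real (card (\<Omega> p)))" for p
  define g where "g p n = (if nat (n mod int p) \<in> \<Omega> p then - 1 / h p else 1)" for p n
  \<comment> \<open>The mean square of \<open>f X\<close> over a period is 1 / \<open>H X\<close>.
    Weighting by \<open>H X\<close> is thus the choice that minimises the diagonal contribution to
    the sum of F^2 for a given value L at the sifted points.\<close>
  define H where "H X = (\<Prod>p\<in>X. h p)" for X
  define f where "f X n = (\<Prod>p\<in>X. g p n)" for X n
  define F where "F n = (\<Sum>X\<in>\<X>. H X * f X n)" for n
  define L where "L = (\<Sum>X\<in>\<X>. H X)"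
  \<comment> \<open>With this origin every z in {1..N} equals c + i + j for each i < N with a
    suitable j < 2N, so the double sum \<open>D\<close> meets z at least N times.\<close>
  define c where "c = 1 - int N"
  define D where "D \<phi> = (\<Sum>i<2*N. \<Sum>j<2*N. \<phi> (c + int i + int j))" for \<phi> :: "int \<Rightarrow> real"
  have h_pos: "h p > 0" if "X \<in> \<X>" "p \<in> X" for X p
    using \<Omega>[OF that] by (simp add: h_def)
  have H_pos: "H X > 0" if "X \<in> \<X>" for X
    unfolding H_def using h_pos that by (intro prod_pos) auto
  have L_nonneg: "L \<ge> 0" unfolding L_def using H_pos by (intro sum_nonneg) (auto intro: less_imp_le)
  have prime: "prime p" if "X \<in> \<X>" "p \<in> X" for X p using \<X> that by blast
  have prod_pos': "\<Prod>X > 0" if "X \<in> \<X>" for X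
    using prime[OF that] by (intro prod_pos) (auto intro: prime_gt_0_nat)
  have g_per: "g p (n + int p) = g p n" for p n by (simp add: g_def)
  have g_sum: "(\<Sum>i<p. g p (int i)) = 0" and g_sum2: "(\<Sum>i<p. (g p (int i))\<^sup>2) = real p / h p"
    if "X \<in> \<X>" "p \<in> X" for X p
  proof -
    note w = \<Omega>[OF that]
    define w where "w = real (card (\<Omega> p))"
    have wp: "0 < w" "w < real p" using w by (auto simp: w_def)
    have fin: "finite (\<Omega> p)" using w finite_subset by blast
    have split: "(\<Sum>i<p. \<psi> (g p (int i))) = w * \<psi> (- 1 / h p) + (real p - w) * \<psi> 1" for \<psi> :: "real \<Rightarrow> real"
    proof -
      have "(\<Sum>i<p. \<psi> (g p (int i))) = (\<Sum>i<p. if i \<in> \<Omega> p then \<psi> (- 1 / h p) else \<psi> 1)"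
        by (intro sum.cong refl) (auto simp: g_def nat_mod_as_int[symmetric] zmod_int[symmetric])
      also have "\<dots> = (\<Sum>i\<in>{..<p} \<inter> \<Omega> p. \<psi> (- 1 / h p)) + (\<Sum>i\<in>{..<p} - \<Omega> p. \<psi> 1)"
        by (subst sum.If_cases) (auto simp: Diff_eq)
      also have "\<dots> = w * \<psi> (- 1 / h p) + real (card ({..<p} - \<Omega> p)) * \<psi> 1"
        using w by (simp add: w_def Int_absorb1)
      also have "real (card ({..<p} - \<Omega> p)) = real p - w"
        using w fin by (subst card_Diff_subset) (auto simp: w_def of_nat_diff)
      finally show ?thesis .
    qed
    have hw: "h p = w / (real p - w)" by (simp add: h_def w_def)
    show "(\<Sum>i<p. g p (int i)) = 0"
      using split[of "\<lambda>x. x"] wp by (simp add: hw field_simps)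
    have "(\<Sum>i<p. (g p (int i))\<^sup>2) = w * (- 1 / h p)\<^sup>2 + (real p - w)"
      using split[of "\<lambda>x. x\<^sup>2"] by simp
    also have "\<dots> = (real p - w) * (real p - w) / w + (real p - w)"
      using wp by (simp add: hw power2_eq_square field_simps)
    also have "\<dots> = real p / h p" using wp by (simp add: hw field_simps)
    finally show "(\<Sum>i<p. (g p (int i))\<^sup>2) = real p / h p" .
  qed
  have f_per: "f X (n + int M) = f X n" if "X \<in> \<X>" "\<Prod>X dvd M" for X n M
  proof -
    have "f X (k + int (\<Prod>X)) = f X k" for k
      unfolding f_def using \<X>[OF that(1)] g_per by (intro prod_primes_periodic) auto
    then show ?thesis by (rule periodic_dvd[OF _ that(2)])
  qed
  have f_sum2: "(\<Sum>i<\<Prod>X. (f X (int i))\<^sup>2) = real (\<Prod>X) / H X" if "X \<in> \<X>" for X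
  proof -
    have "(\<Sum>i<\<Prod>X. (f X (int i))\<^sup>2) = (\<Sum>i<\<Prod>X. \<Prod>p\<in>X. (g p (int i))\<^sup>2)"
      by (simp add: f_def prod_power_distrib)
    also have "\<dots> = (\<Prod>p\<in>X. \<Sum>i<p. (g p (int i))\<^sup>2)"
      using \<X>[OF that] by (intro sum_prod_primes) (auto simp: g_per)
    also have "\<dots> = real (\<Prod>X) / H X"
      using g_sum2[OF that] by (simp add: H_def prod_dividef)
    finally show ?thesis .
  qed
  have f_sum2': "(\<Sum>i<M. (f X (int i))\<^sup>2) = real M / H X" if "X \<in> \<X>" "\<Prod>X dvd M" for X M
  proof -
    from that(2) obtain k where k: "M = k * \<Prod>X" by (metis dvdE mult.commute)
    have "(\<Sum>i<k * \<Prod>X + 0. (f X (0 + int i))\<^sup>2) = real k * (\<Sum>i<\<Prod>X. (f X (int i))\<^sup>2) + 0"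
      by (subst sum_periods[of "\<lambda>n. (f X n)\<^sup>2"]) (simp_all add: f_per[OF that(1)] del: of_nat_prod)
    then show ?thesis using f_sum2[OF that(1)] by (simp add: k)
  qed
  note of_nat_prod [simp del]
  have diag: "D (\<lambda>n. f X n * f X n) \<le> 6 * real N ^ 2 / H X" if "X \<in> \<X>" for X
  proof -
    have QN: "Q \<le> N"
    proof (rule ccontr)
      assume "\<not> Q \<le> N"
      then have "N < Q" by simp
      then have "N ^ 5 < Q ^ 5" by (intro power_strict_mono) auto
      moreover have "N ^ 2 \<le> N ^ 5" using \<open>N > 0\<close> by (intro power_increasing) auto
      ultimately show False using Q(2) by simp
    qed
    have r: "real (\<Prod>X) > 0" using prod_pos'[OF that] by (simp only: of_nat_0_less_iff)
    have "\<Prod>X \<le> N" using Q(1)[OF that] QN by (rule order_trans)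
    then have r': "real (\<Prod>X) \<le> real N" by (simp only: of_nat_le_iff)
    have le: "(\<Sum>j<2*N. (f X (c + int i + int j))\<^sup>2) \<le> 3 * real N / H X" for i
    proof -
      have "(\<Sum>j<2*N. (f X (c + int i + int j))\<^sup>2)
          \<le> (real (2 * N) / real (\<Prod>X) + 1) * (\<Sum>j<\<Prod>X. (f X (int j))\<^sup>2)"
        using prod_pos'[OF that] f_per[OF that dvd_refl]
        by (intro sum_interval_le_periods[of "\<lambda>n. (f X n)\<^sup>2"]) auto
      also have "\<dots> = (real (2 * N) + real (\<Prod>X)) / H X"
        using r H_pos[OF that] by (subst f_sum2[OF that]) (simp add: field_simps)
      also have "\<dots> \<le> 3 * real N / H X"
        using r' H_pos[OF that] by (intro divide_right_mono) auto
      finally show ?thesis .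
    qed
    have "D (\<lambda>n. f X n * f X n) = (\<Sum>i<2*N. \<Sum>j<2*N. (f X (c + int i + int j))\<^sup>2)"
      by (simp add: D_def power2_eq_square)
    also have "\<dots> \<le> (\<Sum>i<2*N. 3 * real N / H X)" by (intro sum_mono le)
    also have "\<dots> = 6 * real N ^ 2 / H X" by (simp add: power2_eq_square)
    finally show ?thesis .
  qed
  have off: "H X * H Y * D (\<lambda>n. f X n * f Y n) \<le> real Q ^ 4 * ((H X + H Y) / 2)"
    if X: "X \<in> \<X>" and Y: "Y \<in> \<X>" and "X \<noteq> Y" for X Y
  proof -
    define U where "U = X \<union> Y"
    define M where "M = \<Prod>U"
    have finX: "finite X" and finY: "finite Y" using \<X>[OF X] \<X>[OF Y] by auto
    have dX: "\<Prod>X dvd M" and dY: "\<Prod>Y dvd M"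
      unfolding M_def U_def using finX finY by (auto intro: prod_dvd_prod_subset)
    have M_pos: "M > 0"
      unfolding M_def U_def using prime[OF X] prime[OF Y] by (intro prod_pos) (auto intro: prime_gt_0_nat)
    have "M * \<Prod>(X \<inter> Y) = \<Prod>X * \<Prod>Y"
      unfolding M_def U_def using finX finY prod.union_inter[of X Y "\<lambda>x. x"] by simp
    moreover have "\<Prod>(X \<inter> Y) > 0" using prime[OF X] by (intro prod_pos) (auto intro: prime_gt_0_nat)
    ultimately have "M \<le> \<Prod>X * \<Prod>Y" by (metis One_nat_def Suc_leI mult.right_neutral mult_le_mono2)
    also have "\<dots> \<le> Q ^ 2" using Q(1)[OF X] Q(1)[OF Y] by (simp add: power2_eq_square mult_le_mono)
    finally have M_le: "M \<le> Q ^ 2" .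
    define \<phi> where "\<phi> p n = (if p \<in> X then g p n else 1) * (if p \<in> Y then g p n else 1)" for p n
    have ff: "f X n * f Y n = (\<Prod>p\<in>U. \<phi> p n)" for n
    proof -
      have "f X n = (\<Prod>p\<in>U. if p \<in> X then g p n else 1)" "f Y n = (\<Prod>p\<in>U. if p \<in> Y then g p n else 1)"
        unfolding f_def U_def using finX finY by (subst prod.inter_restrict[symmetric]; simp add: Int_absorb1 Int_absorb2)+
      then show ?thesis by (simp add: \<phi>_def prod.distrib)
    qed
    \<comment> \<open>A prime lying in exactly one of X and Y contributes the single factor
      \<open>g p\<close>, whose sum over a period vanishes.\<close>
    have zero: "(\<Sum>i<M. f X (int i) * f Y (int i)) = 0"
    proof -
      have "(\<Sum>i<M. f X (int i) * f Y (int i)) = (\<Prod>p\<in>U. \<Sum>i<p. \<phi> p (int i))"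
        unfolding ff M_def using finX finY prime[OF X] prime[OF Y]
        by (intro sum_prod_primes) (auto simp: U_def \<phi>_def g_per)
      moreover obtain p where p: "p \<in> U" "\<not> (p \<in> X \<and> p \<in> Y)"
        using \<open>X \<noteq> Y\<close> unfolding U_def by blast
      moreover have "(\<Sum>i<p. \<phi> p (int i)) = 0"
        using p g_sum[OF X, of p] g_sum[OF Y, of p] by (cases "p \<in> X") (auto simp: \<phi>_def U_def)
      ultimately show ?thesis using finX finY by (auto simp: U_def)
    qed
    have "H X * H Y * D (\<lambda>n. f X n * f Y n) \<le> H X * H Y * (real M * (\<Sum>i<M. \<bar>f X (int i) * f Y (int i)\<bar>))"
    proof (rule mult_left_mono)
      have "\<bar>D (\<lambda>n. f X n * f Y n)\<bar> \<le> real M * (\<Sum>i<M. \<bar>f X (int i) * f Y (int i)\<bar>)"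
        unfolding D_def
        by (rule abs_double_sum_mean_zero) (use zero M_pos f_per[OF X dX] f_per[OF Y dY] in auto)
      then show "D (\<lambda>n. f X n * f Y n) \<le> real M * (\<Sum>i<M. \<bar>f X (int i) * f Y (int i)\<bar>)" by linarith
    qed (use H_pos[OF X] H_pos[OF Y] in auto)
    \<comment> \<open>AM-GM brings in the two known mean squares. With H X * H Y in front, 1 / H X +
      1 / H Y turns into H X + H Y, which sums to a multiple of L.\<close>
    also have "\<dots> \<le> H X * H Y * (real M * (\<Sum>i<M. ((f X (int i))\<^sup>2 + (f Y (int i))\<^sup>2) / 2))"
    proof (intro mult_left_mono sum_mono)
      fix i
      have "0 \<le> (\<bar>f X (int i)\<bar> - \<bar>f Y (int i)\<bar>)\<^sup>2" by simp
      then show "\<bar>f X (int i) * f Y (int i)\<bar> \<le> ((f X (int i))\<^sup>2 + (f Y (int i))\<^sup>2) / 2"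
        by (simp add: power2_diff abs_mult)
    qed (use H_pos[OF X] H_pos[OF Y] in auto)
    also have "(\<Sum>i<M. ((f X (int i))\<^sup>2 + (f Y (int i))\<^sup>2) / 2) = (real M / H X + real M / H Y) / 2"
      by (simp add: sum_divide_distrib[symmetric] sum.distrib f_sum2'[OF X dX] f_sum2'[OF Y dY])
    also have "H X * H Y * (real M * ((real M / H X + real M / H Y) / 2)) = real M ^ 2 * ((H X + H Y) / 2)"
      using H_pos[OF X] H_pos[OF Y] by (simp add: field_simps power2_eq_square)
    also have "\<dots> \<le> real Q ^ 4 * ((H X + H Y) / 2)"
    proof (rule mult_right_mono)
      have "real M \<le> real Q ^ 2" using M_le by (metis of_nat_le_iff of_nat_power)
      then have "real M ^ 2 \<le> (real Q ^ 2) ^ 2" by (intro power_mono) auto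
      then show "real M ^ 2 \<le> real Q ^ 4" by simp
    qed (use H_pos[OF X] H_pos[OF Y] in auto)
    finally show ?thesis .
  qed
  \<comment> \<open>The off-diagonal bounds add up to Q^4 * card \<X> * L, so this estimate makes
    the total Q^5 * L \<le> N^2 * L. This is where the condition \<open>Q ^ 5 \<le> N ^ 2\<close>
    comes from.\<close>
  have card_X: "card \<X> \<le> Q"
  proof -
    have "inj_on (\<lambda>X. \<Prod>X) \<X>" by (rule inj_on_prod_prime_sets[OF \<X>])
    moreover have "(\<lambda>X. \<Prod>X) ` \<X> \<subseteq> {1..Q}" using Q(1) prod_pos' by (auto simp: Suc_le_eq)
    ultimately show ?thesis using card_inj_on_le[of "\<lambda>X. \<Prod>X" \<X> "{1..Q}"] by simp
  qed
  have "D (\<lambda>n. (F n)\<^sup>2) \<le> 7 * real N ^ 2 * L"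
  proof -
    have "D (\<lambda>n. (F n)\<^sup>2) = (\<Sum>X\<in>\<X>. \<Sum>Y\<in>\<X>. H X * H Y * D (\<lambda>n. f X n * f Y n))"
    proof -
      have "(F n)\<^sup>2 = (\<Sum>X\<in>\<X>. \<Sum>Y\<in>\<X>. H X * H Y * (f X n * f Y n))" for n
        by (simp add: F_def power2_eq_square sum_product mult_ac)
      then have "D (\<lambda>n. (F n)\<^sup>2) = (\<Sum>i<2*N. \<Sum>j<2*N. \<Sum>X\<in>\<X>. \<Sum>Y\<in>\<X>.
          H X * H Y * (f X (c + int i + int j) * f Y (c + int i + int j)))" by (simp add: D_def)
      also have "\<dots> = (\<Sum>i<2*N. \<Sum>X\<in>\<X>. \<Sum>Y\<in>\<X>. \<Sum>j<2*N.
          H X * H Y * (f X (c + int i + int j) * f Y (c + int i + int j)))"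
        by (subst sum.swap[of _ \<X>], rule sum.cong[OF refl], rule sum.cong[OF refl], rule sum.swap)
      also have "\<dots> = (\<Sum>X\<in>\<X>. \<Sum>Y\<in>\<X>. \<Sum>i<2*N. \<Sum>j<2*N.
          H X * H Y * (f X (c + int i + int j) * f Y (c + int i + int j)))"
        by (subst sum.swap[of _ \<X>], rule sum.cong[OF refl], rule sum.swap)
      also have "\<dots> = (\<Sum>X\<in>\<X>. \<Sum>Y\<in>\<X>. H X * H Y * D (\<lambda>n. f X n * f Y n))"
        by (simp add: D_def sum_distrib_left)
      finally show ?thesis .
    qed
    also have "\<dots> \<le> (\<Sum>X\<in>\<X>. \<Sum>Y\<in>\<X>. (if Y = X then 6 * real N ^ 2 * H X else 0) + real Q ^ 4 * ((H X + H Y) / 2))"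
    proof (intro sum_mono)
      fix X Y assume X: "X \<in> \<X>" and Y: "Y \<in> \<X>"
      show "H X * H Y * D (\<lambda>n. f X n * f Y n) \<le> (if Y = X then 6 * real N ^ 2 * H X else 0) + real Q ^ 4 * ((H X + H Y) / 2)"
      proof (cases "X = Y")
        case True
        have "H X * H X * D (\<lambda>n. f X n * f X n) \<le> H X * H X * (6 * real N ^ 2 / H X)"
          using H_pos[OF X] by (intro mult_left_mono diag X) auto
        also have "\<dots> = 6 * real N ^ 2 * H X" using H_pos[OF X] by simp
        finally have "H X * H X * D (\<lambda>n. f X n * f X n) \<le> 6 * real N ^ 2 * H X" .
        moreover have "real Q ^ 4 * ((H X + H X) / 2) \<ge> 0" using H_pos[OF X] by simp
        ultimately show ?thesis unfolding True[symmetric] if_P[OF refl] by linarith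
      next
        case False
        then show ?thesis using off[OF X Y] by simp
      qed
    qed
    also have "\<dots> = 6 * real N ^ 2 * L + real Q ^ 4 * (real (card \<X>) * L)"
    proof -
      have "(\<Sum>X\<in>\<X>. \<Sum>Y\<in>\<X>. (H X + H Y) / 2) = real (card \<X>) * L"
        by (simp add: sum_divide_distrib[symmetric] sum.distrib L_def sum_distrib_left[symmetric])
      then have "(\<Sum>X\<in>\<X>. \<Sum>Y\<in>\<X>. real Q ^ 4 * ((H X + H Y) / 2)) = real Q ^ 4 * (real (card \<X>) * L)"
        by (simp only: sum_distrib_left[symmetric])
      moreover have "(\<Sum>X\<in>\<X>. \<Sum>Y\<in>\<X>. if Y = X then 6 * real N ^ 2 * H X else 0) = 6 * real N ^ 2 * L"
        using \<open>finite \<X>\<close> by (simp add: sum_distrib_left L_def)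
      ultimately show ?thesis by (simp only: sum.distrib)
    qed
    also have "\<dots> \<le> 6 * real N ^ 2 * L + real N ^ 2 * L"
    proof -
      have "real Q ^ 4 * real (card \<X>) \<le> real Q ^ 4 * real Q" using card_X by (intro mult_left_mono) auto
      also have "\<dots> = real (Q ^ 5)" by (simp flip: power_Suc2)
      also have "\<dots> \<le> real (N ^ 2)" using Q(2) by linarith
      finally have "real Q ^ 4 * real (card \<X>) * L \<le> real N ^ 2 * L"
        using L_nonneg by (intro mult_right_mono) auto
      then show ?thesis by (simp add: mult_ac)
    qed
    finally show ?thesis by (simp add: mult_ac)
  qed
  moreover have "real N * (real (card Z) * L\<^sup>2) \<le> D (\<lambda>n. (F n)\<^sup>2)"
  proof -
    have FZ: "F z = L" if "z \<in> Z" for z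
    proof -
      have "f X z = 1" if "X \<in> \<X>" for X
        unfolding f_def using sift[OF \<open>X \<in> \<X>\<close> _ \<open>z \<in> Z\<close>] by (intro prod.neutral) (auto simp: g_def)
      then show ?thesis by (simp add: F_def L_def)
    qed
    have "real (card Z) * L\<^sup>2 \<le> (\<Sum>j<2*N. (F (c + int i + int j))\<^sup>2)" if "i < N" for i
    proof -
      have "real (card Z) * L\<^sup>2 = (\<Sum>z\<in>Z. (F z)\<^sup>2)" using FZ by simp
      also have "\<dots> = (\<Sum>j\<in>(\<lambda>z. nat (z - c - int i)) ` Z. (F (c + int i + int j))\<^sup>2)"
      proof (subst sum.reindex)
        show "inj_on (\<lambda>z. nat (z - c - int i)) Z"
          using Z \<open>i < N\<close> by (intro inj_onI) (auto simp: c_def subset_iff)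
        have "c + int i + int (nat (z - c - int i)) = z" if "z \<in> Z" for z
          using Z that \<open>i < N\<close> by (auto simp: c_def subset_iff)
        then show "(\<Sum>z\<in>Z. (F z)\<^sup>2) = (\<Sum>z\<in>Z. ((\<lambda>j. (F (c + int i + int j))\<^sup>2) \<circ> (\<lambda>z. nat (z - c - int i))) z)"
          by (intro sum.cong) auto
      qed
      also have "\<dots> \<le> (\<Sum>j<2*N. (F (c + int i + int j))\<^sup>2)"
        using Z by (intro sum_mono2) (auto simp: c_def subset_iff)
      finally show ?thesis .
    qed
    then have "(\<Sum>i<N. real (card Z) * L\<^sup>2) \<le> (\<Sum>i<N. \<Sum>j<2*N. (F (c + int i + int j))\<^sup>2)"
      by (intro sum_mono) auto
    also have "\<dots> \<le> D (\<lambda>n. (F n)\<^sup>2)"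
      unfolding D_def by (intro sum_mono2 sum_nonneg) auto
    finally show ?thesis by simp
  qed
  ultimately have "real N * (real (card Z) * L\<^sup>2) \<le> 7 * real N ^ 2 * L" by linarith
  then have "(real N * L) * (real (card Z) * L) \<le> (real N * L) * (7 * real N)"
    by (simp add: power2_eq_square mult_ac)
  then have "L > 0 \<Longrightarrow> real (card Z) * L \<le> 7 * real N"
    using \<open>N > 0\<close> by (simp only: mult_le_cancel_left_pos mult_pos_pos of_nat_0_less_iff)
  then have "real (card Z) * L \<le> 7 * real N" using L_nonneg by (cases "L = 0") auto
  then show ?thesis by (simp add: L_def H_def h_def)
qed

section \<open>Elementary symmetric sums, factorials and the sieve for shifts\<close>

text \<open>Double counting of pairs (p, X) with p in X: each set X of size m + 1 arises once from
  each of its m + 1 elements.\<close>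

lemma esym_Suc:
  fixes h :: "'a \<Rightarrow> real"
  assumes "finite P"
  shows "real (Suc m) * (\<Sum>X | X \<subseteq> P \<and> card X = Suc m. \<Prod>p\<in>X. h p)
    = (\<Sum>p\<in>P. h p * (\<Sum>X | X \<subseteq> P - {p} \<and> card X = m. \<Prod>q\<in>X. h q))"
proof -
  let ?E = "\<lambda>m. {X. X \<subseteq> P \<and> card X = m}"
  have fin: "finite (?E k)" for k using assms by simp
  have inner: "h p * (\<Sum>X | X \<subseteq> P - {p} \<and> card X = m. \<Prod>q\<in>X. h q)
      = (\<Sum>X\<in>?E (Suc m). if p \<in> X then \<Prod>q\<in>X. h q else 0)" if "p \<in> P" for p
  proof -
    have "(\<Sum>X\<in>?E (Suc m). if p \<in> X then \<Prod>q\<in>X. h q else 0) = (\<Sum>X\<in>{X \<in> ?E (Suc m). p \<in> X}. \<Prod>q\<in>X. h q)"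
      using fin by (subst sum.inter_filter) auto
    also have "\<dots> = (\<Sum>X | X \<subseteq> P - {p} \<and> card X = m. \<Prod>q\<in>insert p X. h q)"
    proof (rule sum.reindex_bij_witness[of _ "insert p" "\<lambda>X. X - {p}"])
      fix X assume X: "X \<in> {X. X \<subseteq> P - {p} \<and> card X = m}"
      then have "finite X" "p \<notin> X" using assms finite_subset by blast+
      then show "insert p X - {p} = X" "insert p X \<in> {X \<in> ?E (Suc m). p \<in> X}"
        using X \<open>p \<in> P\<close> by auto
    next
      fix X assume X: "X \<in> {X \<in> ?E (Suc m). p \<in> X}"
      then have "finite X" using assms finite_subset by blast
      then show "X - {p} \<in> {X. X \<subseteq> P - {p} \<and> card X = m}" using X by auto
      show "insert p (X - {p}) = X" using X by auto
      then show "(\<Prod>q\<in>insert p (X - {p}). h q) = (\<Prod>q\<in>X. h q)" by simp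
    qed
    also have "\<dots> = (\<Sum>X | X \<subseteq> P - {p} \<and> card X = m. h p * (\<Prod>q\<in>X. h q))"
    proof (rule sum.cong[OF refl])
      fix X assume X: "X \<in> {X. X \<subseteq> P - {p} \<and> card X = m}"
      then have "finite X" "p \<notin> X" using assms finite_subset by blast+
      then show "(\<Prod>q\<in>insert p X. h q) = h p * (\<Prod>q\<in>X. h q)" by simp
    qed
    finally show ?thesis by (simp add: sum_distrib_left)
  qed
  have "(\<Sum>p\<in>P. h p * (\<Sum>X | X \<subseteq> P - {p} \<and> card X = m. \<Prod>q\<in>X. h q))
      = (\<Sum>X\<in>?E (Suc m). \<Sum>p\<in>P. if p \<in> X then \<Prod>q\<in>X. h q else 0)"
    using inner by (subst sum.swap) simp
  also have "\<dots> = (\<Sum>X\<in>?E (Suc m). real (Suc m) * (\<Prod>q\<in>X. h q))"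
  proof (rule sum.cong[OF refl])
    fix X assume X: "X \<in> ?E (Suc m)"
    have "(\<Sum>p\<in>P. if p \<in> X then \<Prod>q\<in>X. h q else 0) = real (card (P \<inter> X)) * (\<Prod>q\<in>X. h q)"
      using assms by (simp add: sum.If_cases)
    then show "(\<Sum>p\<in>P. if p \<in> X then \<Prod>q\<in>X. h q else 0) = real (Suc m) * (\<Prod>q\<in>X. h q)"
      using X by (simp add: Int_absorb1)
  qed
  finally show ?thesis by (simp add: sum_distrib_left)
qed

text \<open>When the elements of X are picked one after another, each pick removes at most H from
  the total, so at every stage at least the full sum minus m * H remains to choose from; dividing by
  m! forgets the order.\<close>

lemma esym_lower_bound:
  fixes h :: "'a \<Rightarrow> real"
  assumes "finite P" and "\<And>p. p \<in> P \<Longrightarrow> 0 \<le> h p \<and> h p \<le> H" and "H \<ge> 0" and "real m * H \<le> (\<Sum>p\<in>P. h p)"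
  shows "((\<Sum>p\<in>P. h p) - real m * H) ^ m / fact m \<le> (\<Sum>X | X \<subseteq> P \<and> card X = m. \<Prod>p\<in>X. h p)"
  using assms
proof (induction m arbitrary: P)
  case 0
  then have "{X. X \<subseteq> P \<and> card X = 0} = {{}}"
    by (auto simp: card_eq_0_iff intro: finite_subset)
  then show ?case by simp
next
  case (Suc m)
  define S where "S = (\<Sum>p\<in>P. h p)"
  define U where "U = S - real (Suc m) * H"
  have U: "U \<ge> 0" using Suc.prems(4) by (simp add: U_def S_def)
  have le: "U ^ m / fact m \<le> (\<Sum>X | X \<subseteq> P - {p} \<and> card X = m. \<Prod>q\<in>X. h q)" if "p \<in> P" for p
  proof -
    have S': "(\<Sum>q\<in>P - {p}. h q) = S - h p" using Suc.prems(1) that by (simp add: S_def sum_diff1)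
    have "U \<le> S - h p - real m * H" using Suc.prems(2)[OF that] by (simp add: U_def algebra_simps)
    then have "U ^ m / fact m \<le> (S - h p - real m * H) ^ m / fact m"
      using U by (intro divide_right_mono power_mono) auto
    also have "\<dots> \<le> (\<Sum>X | X \<subseteq> P - {p} \<and> card X = m. \<Prod>q\<in>X. h q)"
      using Suc.IH[of "P - {p}"] Suc.prems \<open>U \<le> S - h p - real m * H\<close> U by (simp add: S')
    finally show ?thesis .
  qed
  have US: "U \<le> S" using Suc.prems(3) by (simp add: U_def)
  have "U * (U ^ m / fact m) \<le> S * (U ^ m / fact m)"
    using U US by (intro mult_right_mono) auto
  also have "\<dots> = (\<Sum>p\<in>P. h p * (U ^ m / fact m))" by (simp add: S_def sum_distrib_right sum_divide_distrib)
  also have "\<dots> \<le> (\<Sum>p\<in>P. h p * (\<Sum>X | X \<subseteq> P - {p} \<and> card X = m. \<Prod>q\<in>X. h q))"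
    using Suc.prems(2) le by (intro sum_mono mult_left_mono) auto
  also have "\<dots> = real (Suc m) * (\<Sum>X | X \<subseteq> P \<and> card X = Suc m. \<Prod>p\<in>X. h p)"
    by (rule esym_Suc[OF Suc.prems(1), symmetric])
  finally have "U ^ Suc m / fact m \<le> real (Suc m) * (\<Sum>X | X \<subseteq> P \<and> card X = Suc m. \<Prod>p\<in>X. h p)" by simp
  then have "U ^ Suc m / fact m / real (Suc m) \<le> (\<Sum>X | X \<subseteq> P \<and> card X = Suc m. \<Prod>p\<in>X. h p)"
    by (subst pos_divide_le_eq) (auto simp: mult.commute)
  moreover have "U ^ Suc m / fact m / real (Suc m) = U ^ Suc m / fact (Suc m)"
    by (simp add: mult.commute)
  ultimately show ?case by (simp only: U_def S_def)
qed

text \<open>Stirling's upper bound with a linear factor in place of the square root. The induction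
  step is (m / (m + 1))^(m + 1) \<le> exp (-1), from 1 + t \<le> exp t.\<close>

lemma fact_le_power_div_exp:
  assumes "m \<ge> 1"
  shows "fact m \<le> real m * exp 1 * (real m / exp 1) ^ m"
  using assms
proof (induction m rule: dec_induct)
  case (step m)
  have "real m / real (Suc m) = 1 + (- 1 / real (Suc m))" by (simp add: field_simps)
  also have "\<dots> \<le> exp (- 1 / real (Suc m))" by (rule exp_ge_add_one_self)
  finally have "(real m / real (Suc m)) ^ Suc m \<le> exp (- 1 / real (Suc m)) ^ Suc m"
    by (intro power_mono) auto
  also have "\<dots> = exp (- 1)" by (subst exp_of_nat_mult[symmetric]) simp
  finally have "real m ^ Suc m * exp 1 \<le> real (Suc m) ^ Suc m"
    by (simp add: power_divide exp_minus field_simps del: of_nat_Suc power_Suc)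
  then have key: "real m * exp 1 * real m ^ m \<le> real (Suc m) ^ Suc m" by (simp add: mult_ac)
  have "fact (Suc m) = real (Suc m) * fact m" by simp
  also have "\<dots> \<le> real (Suc m) * (real m * exp 1 * (real m / exp 1) ^ m)"
    by (intro mult_left_mono step.IH) auto
  also have "\<dots> = real (Suc m) * ((real m * exp 1 * real m ^ m) / exp 1 ^ m)"
    by (simp add: power_divide)
  also have "\<dots> \<le> real (Suc m) * (real (Suc m) ^ Suc m / exp 1 ^ m)"
    by (intro mult_left_mono divide_right_mono key) auto
  also have "\<dots> = real (Suc m) * exp 1 * (real (Suc m) / exp 1) ^ Suc m"
    by (simp add: power_divide del: of_nat_Suc)
  finally show ?case .
qed simp

text \<open>The term of the exponential series with index near U is within a factor of order U of
  exp U. Of the 2 in the exponent, one unit comes from the factor e in the factorial bound and one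
  from rounding U down.\<close>

lemma power_floor_div_fact_ge:
  fixes U :: real
  assumes "U \<ge> 1"
  shows "exp (U - 2) / U \<le> U ^ nat \<lfloor>U\<rfloor> / fact (nat \<lfloor>U\<rfloor>)"
proof -
  define m where "m = nat \<lfloor>U\<rfloor>"
  have m: "m \<ge> 1" "real m \<le> U" "U \<le> real m + 1" using assms unfolding m_def by linarith+
  have pos: "real m * exp 1 * (real m / exp 1) ^ m > 0" using m by simp
  have "exp (U - 2) / U \<le> exp (real m - 1) / real m"
    using m by (intro frac_le) auto
  also have "\<dots> = real m ^ m / (real m * exp 1 * (real m / exp 1) ^ m)"
    using m by (simp add: power_divide exp_diff exp_of_nat_mult[of m 1, simplified])
  also have "\<dots> \<le> U ^ m / fact m"
    using m fact_le_power_div_exp[OF m(1)] by (intro frac_le power_mono) auto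
  finally show ?thesis by (simp add: m_def)
qed

text \<open>Each p in P forbids to z the negatives of the residues of D. The sieve weight w / (p -
  w) is weakened to w / p, and since a product of m primes of P is at most y^m, this power is the
  sieve level.\<close>

lemma sieve_shifts:
  fixes Z D P :: "nat set"
  assumes "finite D" "D \<noteq> {}" and Z: "Z \<subseteq> {1..N}" and "finite P" and P: "\<And>p. p \<in> P \<Longrightarrow> prime p \<and> p \<le> y"
    and sift: "\<And>p z d. p \<in> P \<Longrightarrow> z \<in> Z \<Longrightarrow> d \<in> D \<Longrightarrow> \<not> p dvd z + d"
    and y: "y ^ (5 * m) \<le> N ^ 2" and "N > 0"
  shows "real (card Z) * (\<Sum>X | X \<subseteq> P \<and> card X = m. \<Prod>p\<in>X. real (card ((\<lambda>d. d mod p) ` D)) / real p) \<le> 7 * real N"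
proof (cases "Z = {}")
  case False
  then obtain z0 where z0: "z0 \<in> Z" by blast
  \<comment> \<open>For the residue 0 the difference p - r is p itself, so the outer mod is needed
    to bring it back to 0.\<close>
  define \<Omega> where "\<Omega> p = (\<lambda>r. (p - r) mod p) ` ((\<lambda>d. d mod p) ` D)" for p
  have sift': "z mod p \<notin> \<Omega> p" if "p \<in> P" "z \<in> Z" for p z
  proof
    assume "z mod p \<in> \<Omega> p"
    then obtain d where d: "d \<in> D" "z mod p = (p - d mod p) mod p" by (auto simp: \<Omega>_def)
    have p: "p > 0" using P[OF that(1)] prime_gt_0_nat by blast
    have "(z + d) mod p = (z mod p + d mod p) mod p" by (simp add: mod_add_eq)
    also have "\<dots> = ((p - d mod p) + d mod p) mod p" by (simp only: d(2) mod_add_left_eq)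
    also have "(p - d mod p) + d mod p = p" using p by (simp add: less_imp_le)
    finally show False using sift[OF that d(1)] by (simp add: dvd_eq_mod_eq_0)
  qed
  have card_\<Omega>: "card (\<Omega> p) = card ((\<lambda>d. d mod p) ` D)" if "p \<in> P" for p
    unfolding \<Omega>_def
  proof (rule card_image, rule inj_onI)
    have p: "p > 0" using P[OF that] prime_gt_0_nat by blast
    fix r s assume "r \<in> (\<lambda>d. d mod p) ` D" "s \<in> (\<lambda>d. d mod p) ` D" and eq: "(p - r) mod p = (p - s) mod p"
    then have rs: "r < p" "s < p" using p by auto
    have refl_mod: "(p - (p - t) mod p) mod p = t" if "t < p" for t
      using that by (cases "t = 0") auto
    show "r = s" by (metis refl_mod[OF rs(1)] refl_mod[OF rs(2)] eq)
  qed
  have \<Omega>: "\<Omega> p \<subseteq> {..<p} \<and> 0 < card (\<Omega> p) \<and> card (\<Omega> p) < p" if "p \<in> P" for p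
  proof -
    have p: "p > 0" using P[OF that] prime_gt_0_nat by blast
    then have sub: "\<Omega> p \<subseteq> {..<p}" by (auto simp: \<Omega>_def)
    \<comment> \<open>An actual sifted element shows that some class is left over, so the sieve
      weight has a positive denominator. This is why the case of empty Z is split off.\<close>
    moreover have "z0 mod p \<in> {..<p} - \<Omega> p" using p sift'[OF that z0] by simp
    ultimately have "\<Omega> p \<subset> {..<p}" by blast
    then have "card (\<Omega> p) < card {..<p}" by (intro psubset_card_mono) auto
    moreover have "finite (\<Omega> p)" "\<Omega> p \<noteq> {}" using assms(1,2) by (auto simp: \<Omega>_def)
    ultimately show ?thesis using sub by (simp add: card_gt_0_iff)
  qed
  have "(\<Sum>X | X \<subseteq> P \<and> card X = m. \<Prod>p\<in>X. real (card ((\<lambda>d. d mod p) ` D)) / real p)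
      \<le> (\<Sum>X | X \<subseteq> P \<and> card X = m. \<Prod>p\<in>X. real (card (\<Omega> p)) / (real p - real (card (\<Omega> p))))"
  proof (intro sum_mono prod_mono conjI)
    fix X p assume "X \<in> {X. X \<subseteq> P \<and> card X = m}" "p \<in> X"
    then have "p \<in> P" by blast
    then show "real (card ((\<lambda>d. d mod p) ` D)) / real p \<le> real (card (\<Omega> p)) / (real p - real (card (\<Omega> p)))"
      using \<Omega>[OF \<open>p \<in> P\<close>] by (subst card_\<Omega>[symmetric]) (auto intro!: divide_left_mono)
  qed auto
  then have "real (card Z) * (\<Sum>X | X \<subseteq> P \<and> card X = m. \<Prod>p\<in>X. real (card ((\<lambda>d. d mod p) ` D)) / real p)
      \<le> real (card Z) * (\<Sum>X | X \<subseteq> P \<and> card X = m. \<Prod>p\<in>X. real (card (\<Omega> p)) / (real p - real (card (\<Omega> p))))"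
    by (rule mult_left_mono) simp
  also have "\<dots> = real (card (int ` Z)) * (\<Sum>X | X \<subseteq> P \<and> card X = m. \<Prod>p\<in>X. real (card (\<Omega> p)) / (real p - real (card (\<Omega> p))))"
    by (simp add: card_image)
  also have "\<dots> \<le> 7 * real N"
  proof (rule elementary_sieve)
    show "finite {X. X \<subseteq> P \<and> card X = m}" using \<open>finite P\<close> by simp
    show "finite X \<and> (\<forall>p\<in>X. prime p)" if "X \<in> {X. X \<subseteq> P \<and> card X = m}" for X
      using that P \<open>finite P\<close> finite_subset by blast
    show "\<Omega> p \<subseteq> {..<p} \<and> 0 < card (\<Omega> p) \<and> card (\<Omega> p) < p" if "X \<in> {X. X \<subseteq> P \<and> card X = m}" "p \<in> X" for X p
      using that by (intro \<Omega>) auto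
    show "int ` Z \<subseteq> {1..int N}" using Z by auto
    show "nat (z mod int p) \<notin> \<Omega> p" if "X \<in> {X. X \<subseteq> P \<and> card X = m}" "p \<in> X" "z \<in> int ` Z" for X p z
      using that sift' by (auto simp: zmod_int[symmetric])
    show "\<Prod>X \<le> y ^ m" if "X \<in> {X. X \<subseteq> P \<and> card X = m}" for X
      using that P prod_mono[of X "\<lambda>p. p" "\<lambda>_. y"] by (auto simp: prod_constant)
    show "(y ^ m) ^ 5 \<le> N\<^sup>2" using y by (simp add: power_mult[symmetric] mult.commute)
  qed fact
  finally show ?thesis .
qed simp

section \<open>Sets of primes with a logarithmic density\<close>

lemma card_multiples: "d > 0 \<Longrightarrow> card {k\<in>{1..n}. d dvd k} = n div d" for n d :: nat
proof -
  assume d: "d > 0"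
  have "bij_betw (\<lambda>j. j * d) {1..n div d} {k\<in>{1..n}. d dvd k}"
  proof (rule bij_betw_imageI)
    show "inj_on (\<lambda>j. j * d) {1..n div d}" using d by (auto simp: inj_on_def)
    have "k \<in> (\<lambda>j. j * d) ` {1..n div d}" if "k \<in> {1..n}" "d dvd k" for k
    proof -
      have "k = (k div d) * d" using that by simp
      moreover have "k div d \<in> {1..n div d}"
        using that d by (auto simp: div_le_mono Suc_le_eq div_greater_zero_iff dest: dvd_imp_le)
      ultimately show ?thesis by blast
    qed
    moreover have "j * d \<in> {1..n}" if "j \<in> {1..n div d}" for j
    proof -
      have "j * d \<le> (n div d) * d" using that by (intro mult_le_mono1) auto
      also have "\<dots> \<le> n" by simp
      finally show ?thesis using that d by (auto simp: Suc_le_eq)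
    qed
    ultimately show "(\<lambda>j. j * d) ` {1..n div d} = {k\<in>{1..n}. d dvd k}" by auto
  qed
  then show ?thesis using bij_betw_same_card by fastforce
qed

text \<open>Legendre's formula in logarithmic form. The free upper limit \<open>m\<close> costs
  nothing, as n div d = 0 for d > n, and lets n! and (2n)! be expanded over one range of d.\<close>

lemma ln_fact_mangoldt:
  assumes "n \<le> m"
  shows "ln (fact n) = (\<Sum>d=1..m. mangoldt d * real (n div d))"
proof -
  have "ln (fact n :: real) = (\<Sum>k=1..n. ln (real k))"
    by (induction n) (simp_all add: ln_mult)
  also have "\<dots> = (\<Sum>k=1..n. \<Sum>d=1..m. if d dvd k then mangoldt d else 0)"
  proof (rule sum.cong[OF refl])
    fix k assume k: "k \<in> {1..n}"
    have "ln (real k) = (\<Sum>d | d dvd k. mangoldt d)"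
      using mangoldt_sum[of k, where ?'a = real] k by simp
    also have "{d. d dvd k} = {1..m} \<inter> {d. d dvd k}"
    proof -
      have "1 \<le> d \<and> d \<le> m" if "d dvd k" for d
        using k assms dvd_imp_le[OF that] dvd_pos_nat[OF _ that] by (auto simp: Suc_le_eq)
      then show ?thesis by auto
    qed
    also have "(\<Sum>d\<in>{1..m} \<inter> {d. d dvd k}. mangoldt d) = (\<Sum>d=1..m. if d dvd k then mangoldt d else 0)"
      by (simp add: sum.inter_restrict)
    finally show "ln (real k) = (\<Sum>d=1..m. if d dvd k then mangoldt d else 0)" .
  qed
  also have "\<dots> = (\<Sum>d=1..m. \<Sum>k=1..n. if d dvd k then mangoldt d else 0)"
    by (rule sum.swap)
  also have "\<dots> = (\<Sum>d=1..m. mangoldt d * real (n div d))"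
  proof (rule sum.cong[OF refl])
    fix d assume "d \<in> {1..m}"
    then have "card {k\<in>{1..n}. d dvd k} = n div d" by (intro card_multiples) auto
    moreover have "{1..n} \<inter> {k. d dvd k} = {k\<in>{1..n}. d dvd k}" by blast
    ultimately have "card ({1..n} \<inter> {k. d dvd k}) = n div d" by (simp only:)
    then show "(\<Sum>k=1..n. if d dvd k then mangoldt d else 0) = mangoldt d * real (n div d)"
      by (simp add: sum.If_cases mult.commute)
  qed
  finally show ?thesis .
qed

lemma ln_fact_bounds:
  "real n * ln (real n) - real n \<le> ln (fact n)" "ln (fact n :: real) \<le> real n * ln (real n)"
proof -
  show "real n * ln (real n) - real n \<le> ln (fact n)"
  proof (induction n)
    case (Suc n)
    have "real n * (ln (real (Suc n)) - ln (real n)) \<le> 1"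
    proof (cases "n = 0")
      case False
      then have "ln (real (Suc n)) - ln (real n) = ln (1 + 1 / real n)"
        by (subst ln_divide_pos[symmetric]) (auto simp: field_simps)
      also have "\<dots> \<le> 1 / real n" using False by (intro ln_add_one_self_le_self) auto
      finally show ?thesis using False by (simp add: field_simps)
    qed simp
    then have "real (Suc n) * ln (real (Suc n)) - real (Suc n) \<le> ln (real (Suc n)) + (real n * ln (real n) - real n)"
      by (simp add: algebra_simps)
    also have "\<dots> \<le> ln (real (Suc n)) + ln (fact n)" using Suc by simp
    also have "\<dots> = ln (fact (Suc n))" by (simp add: ln_mult)
    finally show ?case .
  qed simp
  have "ln (fact n :: real) \<le> ln (real n ^ n)" if "n > 0"
    using fact_le_power[of n, where ?'a = real] that by (subst ln_le_cancel_iff) auto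
  then show "ln (fact n :: real) \<le> real n * ln (real n)" by (cases "n = 0") (auto simp: ln_realpow)
qed

definition chebyshev_psi :: "nat \<Rightarrow> real" where
  "chebyshev_psi n = (\<Sum>d=1..n. mangoldt d)"

text \<open>Chebyshev's argument: (2n)! / (n!)^2 is a binomial coefficient of size at most 4^n, and
  in its Mangoldt expansion the coefficient floor(2n/d) - 2 floor(n/d) is never negative and is at
  least 1 for n < d \<le> 2n.\<close>

lemma chebyshev_psi_double: "chebyshev_psi (2 * n) - chebyshev_psi n \<le> 2 * real n * ln 2"
proof -
  have "chebyshev_psi (2 * n) - chebyshev_psi n = (\<Sum>d\<in>{1..2*n} - {1..n}. mangoldt d)"
    unfolding chebyshev_psi_def by (subst sum_diff) auto
  also have "\<dots> \<le> (\<Sum>d\<in>{1..2*n} - {1..n}. mangoldt d * (real (2 * n div d) - 2 * real (n div d)))"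
  proof (rule sum_mono)
    fix d assume d: "d \<in> {1..2*n} - {1..n}"
    then have "n div d = 0" "2 * n div d \<ge> 1" by (auto simp: div_greater_zero_iff Suc_le_eq)
    then have "real (2 * n div d) - 2 * real (n div d) \<ge> 1" by simp
    then show "mangoldt d \<le> mangoldt d * (real (2 * n div d) - 2 * real (n div d))"
      using mult_left_mono[of 1 "real (2 * n div d) - 2 * real (n div d)" "mangoldt d"] mangoldt_nonneg by simp
  qed
  also have "\<dots> \<le> (\<Sum>d=1..2*n. mangoldt d * (real (2 * n div d) - 2 * real (n div d)))"
  proof (rule sum_mono2)
    fix d
    have "2 * (n div d) \<le> 2 * n div d" by (metis div_mult2_eq mult.commute times_div_less_eq_dividend div_mult1_eq le_add1 mult_2 add_le_mono div_add1_eq order_trans)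
    then show "0 \<le> mangoldt d * (real (2 * n div d) - 2 * real (n div d))"
      using mangoldt_nonneg[of d] by (intro mult_nonneg_nonneg) (auto simp flip: of_nat_le_iff[where ?'a = real])
  qed auto
  also have "\<dots> = ln (fact (2 * n)) - 2 * ln (fact n)"
    unfolding ln_fact_mangoldt[of n "2 * n", OF le_add2[of n n, folded mult_2]] ln_fact_mangoldt[of "2 * n", OF order_refl]
    by (simp add: sum_subtractf sum_distrib_left right_diff_distrib mult_ac)
  also have "\<dots> = ln (real (2 * n choose n))"
  proof -
    have "fact (2 * n) = (fact n * fact n * real (2 * n choose n) :: real)"
      using binomial_fact_lemma[of n "2 * n"] by (metis diff_add_inverse2 le_add2 mult_2 of_nat_fact of_nat_mult)
    moreover have "real (2 * n choose n) > 0" by simp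
    ultimately show ?thesis by (simp add: ln_mult)
  qed
  also have "\<dots> \<le> ln (2 ^ (2 * n))"
  proof -
    have "real (2 * n choose n) \<le> 2 ^ (2 * n)"
      using binomial_le_pow2[of "2 * n" n] by (metis of_nat_le_iff of_nat_numeral of_nat_power)
    then show ?thesis by (subst ln_le_cancel_iff) auto
  qed
  also have "\<dots> = 2 * real n * ln 2" by (simp add: ln_realpow)
  finally show ?thesis .
qed

lemma chebyshev_psi_le: "chebyshev_psi n \<le> 6 * real n"
proof (induction n rule: less_induct)
  case (less n)
  show ?case
  proof (cases "n \<le> 1")
    case True
    then have "n = 0 \<or> n = 1" by auto
    then show ?thesis by (auto simp: chebyshev_psi_def)
  next
    case False
    define m where "m = (n + 1) div 2"
    have m: "m < n" "n \<le> 2 * m" "2 * m \<le> n + 1" using False by (auto simp: m_def)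
    have "chebyshev_psi n \<le> chebyshev_psi (2 * m)"
      unfolding chebyshev_psi_def using m by (intro sum_mono2) (auto intro: mangoldt_nonneg)
    also have "\<dots> \<le> chebyshev_psi m + 2 * real m * ln 2" using chebyshev_psi_double[of m] by linarith
    also have "\<dots> \<le> 6 * real m + 2 * real m * 1"
      using less[OF m(1)] ln_le_minus_one[of "2::real"] by (intro add_mono mult_left_mono) auto
    \<comment> \<open>The left side is 8m \<le> 4(n + 1), which is at most 6n because n \<ge>
      2.\<close>
    also have "\<dots> \<le> 6 * real n"
      using m False by linarith
    finally show ?thesis .
  qed
qed

text \<open>Mertens' argument: ln n! is n ln n up to n, and replacing n div d by n / d in its
  Mangoldt expansion changes it by at most \<open>chebyshev_psi n\<close>, hence by at most
  6n.\<close>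

lemma mertens_mangoldt:
  assumes "n \<ge> 1"
  shows "\<bar>(\<Sum>d=1..n. mangoldt d / real d) - ln (real n)\<bar> \<le> 6"
proof -
  define S where "S = (\<Sum>d=1..n. mangoldt d / real d)"
  have n: "real n > 0" using assms by simp
  have "ln (fact n) \<le> (\<Sum>d=1..n. mangoldt d * (real n / real d))"
    unfolding ln_fact_mangoldt[OF order_refl]
    by (intro sum_mono mult_left_mono of_nat_div_le_of_nat mangoldt_nonneg)
  also have "\<dots> = real n * S" by (simp add: S_def sum_distrib_left mult_ac)
  finally have "real n * (ln (real n) - 1) \<le> real n * S"
    using ln_fact_bounds(1)[of n] by (simp add: algebra_simps)
  then have lower: "ln (real n) - 1 \<le> S" using n by simp
  have "real n * S - chebyshev_psi n = (\<Sum>d=1..n. mangoldt d * (real n / real d - 1))"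
    by (simp add: S_def chebyshev_psi_def sum_distrib_left sum_subtractf algebra_simps)
  also have "\<dots> \<le> (\<Sum>d=1..n. mangoldt d * real (n div d))"
  proof (intro sum_mono mult_left_mono mangoldt_nonneg)
    fix d assume d: "d \<in> {1..n}"
    have "n = (n div d) * d + n mod d" by simp
    then have "real n = real (n div d) * real d + real (n mod d)" by (metis of_nat_add of_nat_mult)
    moreover have "real (n mod d) \<le> real d" using d by (simp add: less_imp_le)
    ultimately show "real n / real d - 1 \<le> real (n div d)" using d by (simp add: field_simps)
  qed
  also have "\<dots> = ln (fact n)" by (rule ln_fact_mangoldt[symmetric]) simp
  finally have "real n * S \<le> real n * (ln (real n) + 6)"
    using ln_fact_bounds(2)[of n] chebyshev_psi_le[of n] by (simp add: algebra_simps)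
  then have "S \<le> ln (real n) + 6" using n by simp
  with lower show ?thesis by (simp add: S_def)
qed

lemma sum_ln_div_consecutive_le: "(\<Sum>k=2..n. ln (real k) / (real k * (real k - 1))) \<le> 2"
proof -
  \<comment> \<open>The bound 2 is sharpened by the telescoping term (ln n + 2) / n, which drops by
    at least the new summand at each step and makes the start n = 1 an equality.\<close>
  have "(\<Sum>k=2..n. ln (real k) / (real k * (real k - 1))) \<le> 2 - (ln (real n) + 2) / real n" if "n \<ge> 1"
    using that
  proof (induction n rule: dec_induct)
    case (step n)
    have n: "real n \<ge> 1" using step by simp
    have "(real n + 1) * (ln (real n + 1) - ln (real n)) \<le> 2"
    proof -
      have "ln (real n + 1) - ln (real n) = ln (1 + 1 / real n)"
        using n by (subst ln_divide_pos[symmetric]) (auto simp: field_simps)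
      also have "\<dots> \<le> 1 / real n" using n by (intro ln_add_one_self_le_self) auto
      finally have "(real n + 1) * (ln (real n + 1) - ln (real n)) \<le> (real n + 1) * (1 / real n)"
        by (intro mult_left_mono) auto
      also have "\<dots> \<le> 2" using n by (simp add: field_simps)
      finally show ?thesis .
    qed
    then have "ln (real n + 1) + real n * (ln (real n + 1) + 2) \<le> (real n + 1) * (ln (real n) + 2)"
      by (simp add: algebra_simps)
    then have "(ln (real n + 1) + real n * (ln (real n + 1) + 2)) / (real n * (real n + 1))
        \<le> (real n + 1) * (ln (real n) + 2) / (real n * (real n + 1))"
      using n by (intro divide_right_mono) auto
    then have "ln (real n + 1) / (real n * (real n + 1)) + (ln (real n + 1) + 2) / (real n + 1) \<le> (ln (real n) + 2) / real n"
      using n by (simp add: add_divide_distrib)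
    moreover have "(\<Sum>k=2..Suc n. ln (real k) / (real k * (real k - 1)))
        = (\<Sum>k=2..n. ln (real k) / (real k * (real k - 1))) + ln (real n + 1) / (real n * (real n + 1))"
      using n by (simp add: algebra_simps)
    ultimately show ?case using step.IH by (simp add: add.commute)
  qed simp
  moreover have "(ln (real n) + 2) / real n \<ge> 0"
    by (cases "n = 0") (auto intro!: divide_nonneg_nonneg add_nonneg_nonneg)
  ultimately show ?thesis by (cases "n \<ge> 1") (linarith, simp)
qed

text \<open>Only the higher prime powers separate the two sums. For each p they form a geometric
  series with sum at most ln p / (p (p - 1)).\<close>

lemma mangoldt_prime_power_tail:
  "\<bar>(\<Sum>d=1..n. mangoldt d / real d) - (\<Sum>p | prime p \<and> p \<le> n. ln (real p) / real p)\<bar> \<le> 2"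
proof -
  let ?R = "{d\<in>{1..n}. primepow d \<and> \<not> prime d}" and ?P = "{p. prime p \<and> p \<le> n}"
  have "(\<Sum>d=1..n. mangoldt d / real d) = (\<Sum>d\<in>?R \<union> ?P. mangoldt d / real d :: real)"
    by (rule sum.mono_neutral_right) (auto simp: mangoldt_def Suc_le_eq prime_gt_0_nat)
  also have "\<dots> = (\<Sum>d\<in>?R. mangoldt d / real d) + (\<Sum>p\<in>?P. mangoldt p / real p)"
    by (rule sum.union_disjoint) auto
  also have "(\<Sum>p\<in>?P. mangoldt p / real p :: real) = (\<Sum>p\<in>?P. ln (real p) / real p)"
    by (rule sum.cong) auto
  finally have eq: "(\<Sum>d=1..n. mangoldt d / real d) - (\<Sum>p\<in>?P. ln (real p) / real p) = (\<Sum>d\<in>?R. mangoldt d / real d)"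
    by simp
  have "?R \<subseteq> (\<lambda>(p, k). p ^ k) ` (?P \<times> {2..n})"
  proof
    fix d assume d: "d \<in> ?R"
    then obtain p k where pk: "prime p" "k > 0" "d = p ^ k" by (auto simp: primepow_def)
    have "k \<noteq> 1" using d pk by auto
    moreover have "p \<le> d" using pk self_le_power[of p k] prime_gt_0_nat[of p] by (simp add: Suc_le_eq)
    moreover have "k \<le> d"
      using less_exp[of k] power_mono[of 2 p k] prime_ge_2_nat[OF pk(1)] pk(3) by simp
    ultimately show "d \<in> (\<lambda>(p, k). p ^ k) ` (?P \<times> {2..n})"
      using d pk by (intro image_eqI[of _ _ "(p, k)"]) auto
  qed
  then have "(\<Sum>d\<in>?R. mangoldt d / real d) \<le> (\<Sum>d\<in>(\<lambda>(p, k). p ^ k) ` (?P \<times> {2..n}). mangoldt d / real d :: real)"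
    by (intro sum_mono2) (auto intro: mangoldt_nonneg divide_nonneg_nonneg)
  also have "\<dots> \<le> (\<Sum>z\<in>?P \<times> {2..n}. mangoldt ((\<lambda>(p, k). p ^ k) z) / real ((\<lambda>(p, k). p ^ k) z))"
    by (rule sum_image_le[of _ "\<lambda>d. mangoldt d / real d", unfolded comp_def]) (auto intro: mangoldt_nonneg divide_nonneg_nonneg)
  also have "\<dots> = (\<Sum>(p, k)\<in>?P \<times> {2..n}. ln (real p) * (1 / real p) ^ k)"
    by (intro sum.cong refl) (auto simp: power_divide)
  also have "\<dots> = (\<Sum>p\<in>?P. ln (real p) * (\<Sum>k=2..n. (1 / real p) ^ k))"
    by (simp add: sum.cartesian_product sum_distrib_left)
  also have "\<dots> \<le> (\<Sum>p\<in>?P. ln (real p) / (real p * (real p - 1)))"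
  proof (rule sum_mono)
    fix p assume "p \<in> ?P"
    then have p: "real p \<ge> 2" using prime_ge_2_nat by force
    have "(\<Sum>k=2..n. (1 / real p) ^ k) \<le> (1 / real p)\<^sup>2 / (1 - 1 / real p)"
      using p by (auto simp: sum_gp intro!: divide_right_mono)
    also have "\<dots> = 1 / (real p * (real p - 1))" using p by (simp add: field_simps power2_eq_square)
    finally have "ln (real p) * (\<Sum>k=2..n. (1 / real p) ^ k) \<le> ln (real p) * (1 / (real p * (real p - 1)))"
      using p by (intro mult_left_mono) auto
    then show "ln (real p) * (\<Sum>k=2..n. (1 / real p) ^ k) \<le> ln (real p) / (real p * (real p - 1))" by simp
  qed
  also have "\<dots> \<le> (\<Sum>k=2..n. ln (real k) / (real k * (real k - 1)))"
    by (intro sum_mono2) (auto intro!: divide_nonneg_nonneg mult_nonneg_nonneg dest: prime_ge_2_nat)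
  also have "\<dots> \<le> 2" by (rule sum_ln_div_consecutive_le)
  finally have "(\<Sum>d\<in>?R. mangoldt d / real d) \<le> (2::real)" .
  moreover have "(\<Sum>d\<in>?R. mangoldt d / real d) \<ge> (0::real)"
    by (intro sum_nonneg divide_nonneg_nonneg mangoldt_nonneg) auto
  ultimately show ?thesis unfolding eq by linarith
qed

section \<open>Logarithmic density and partial summation\<close>

text \<open>Only a bounded error is asked for, not convergence to a constant as in the hypothesis on
  \<open>T\<close>. Partial summation needs no more, the crude Mertens bound above provides it for
  all primes, and it passes to the primes outside \<open>T\<close> by subtraction.\<close>

definition log_density :: "nat set \<Rightarrow> real \<Rightarrow> bool" where
  "log_density P \<kappa> \<longleftrightarrow> (\<forall>p\<in>P. prime p) \<and>
     (\<exists>E. \<forall>n\<ge>1. \<bar>(\<Sum>p | p \<in> P \<and> p \<le> n. ln (real p) / real p) - \<kappa> * ln (real n)\<bar> \<le> E)"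

lemma log_density_primes: "log_density {p. prime p} 1"
proof -
  have "\<bar>(\<Sum>p | p \<in> {p. prime p} \<and> p \<le> n. ln (real p) / real p) - 1 * ln (real n)\<bar> \<le> 8" if "n \<ge> 1" for n :: nat
    using mangoldt_prime_power_tail[of n] mertens_mangoldt[OF that] by simp
  then show ?thesis unfolding log_density_def by blast
qed

lemma log_density_Diff:
  assumes P: "log_density P \<kappa>" and R: "log_density R \<rho>" and "R \<subseteq> P"
  shows "log_density (P - R) (\<kappa> - \<rho>)"
proof -
  obtain E where E: "\<And>n. n \<ge> 1 \<Longrightarrow> \<bar>(\<Sum>p | p \<in> P \<and> p \<le> n. ln (real p) / real p) - \<kappa> * ln (real n)\<bar> \<le> E"
    using P unfolding log_density_def by blast
  obtain E' where E': "\<And>n. n \<ge> 1 \<Longrightarrow> \<bar>(\<Sum>p | p \<in> R \<and> p \<le> n. ln (real p) / real p) - \<rho> * ln (real n)\<bar> \<le> E'"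
    using R unfolding log_density_def by blast
  have "\<bar>(\<Sum>p | p \<in> P - R \<and> p \<le> n. ln (real p) / real p) - (\<kappa> - \<rho>) * ln (real n)\<bar> \<le> E + E'" if "n \<ge> 1" for n
  proof -
    have "{p. p \<in> P - R \<and> p \<le> n} = {p. p \<in> P \<and> p \<le> n} - {p. p \<in> R \<and> p \<le> n}" by auto
    then have "(\<Sum>p | p \<in> P - R \<and> p \<le> n. ln (real p) / real p)
        = (\<Sum>p | p \<in> P \<and> p \<le> n. ln (real p) / real p) - (\<Sum>p | p \<in> R \<and> p \<le> n. ln (real p) / real p)"
      using \<open>R \<subseteq> P\<close> by (simp only:) (subst sum_diff, auto)
    then show ?thesis using E[OF that] E'[OF that] by (simp add: algebra_simps)
  qed
  then show ?thesis using P unfolding log_density_def by blast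
qed

text \<open>From some n0 on the error is within 1 of C; the finitely many smaller n are absorbed by
  adding all their errors to the constant.\<close>

lemma log_density_of_asymptotics:
  fixes T :: "nat set"
  assumes "\<forall>p\<in>T. prime p"
    and "(\<lambda>x::real. (\<Sum>p\<in>{p\<in>T. real p \<le> x}. ln (real p) / real p) - (\<tau> * ln x + C)) \<in> o[at_top](\<lambda>_. 1)"
  shows "log_density T \<tau>"
proof -
  define S where "S n = (\<Sum>p | p \<in> T \<and> p \<le> n. ln (real p) / real p) - \<tau> * ln (real n)" for n
  have "\<forall>\<^sub>F x in at_top. norm ((\<Sum>p\<in>{p\<in>T. real p \<le> x}. ln (real p) / real p) - (\<tau> * ln x + C)) \<le> 1 * norm (1::real)"
    using landau_o.smallD[OF assms(2), of 1] by simp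
  then obtain x0 where x0: "\<And>x. x \<ge> x0 \<Longrightarrow> \<bar>(\<Sum>p\<in>{p\<in>T. real p \<le> x}. ln (real p) / real p) - (\<tau> * ln x + C)\<bar> \<le> 1"
    by (auto simp: eventually_at_top_linorder)
  define n0 where "n0 = nat \<lceil>x0\<rceil>"
  have large: "\<bar>S n\<bar> \<le> 1 + \<bar>C\<bar>" if "n \<ge> n0" for n
  proof -
    have "real n \<ge> x0" using that unfolding n0_def by linarith
    from x0[OF this] show ?thesis by (simp add: S_def)
  qed
  have "\<bar>S n\<bar> \<le> 1 + \<bar>C\<bar> + (\<Sum>k<n0. \<bar>S k\<bar>)" for n
  proof (cases "n \<ge> n0")
    case True
    have "(\<Sum>k<n0. \<bar>S k\<bar>) \<ge> 0" by (intro sum_nonneg) auto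
    then show ?thesis using large[OF True] by linarith
  next
    case False
    then have "\<bar>S n\<bar> \<le> (\<Sum>k<n0. \<bar>S k\<bar>)" by (intro member_le_sum) auto
    then show ?thesis by linarith
  qed
  then show ?thesis using assms(1) unfolding log_density_def S_def by blast
qed

lemma finite_members_le: "finite {p. p \<in> P \<and> p \<le> (n::nat)}"
  by (rule finite_subset[of _ "{..n}"]) auto

text \<open>Partial summation from the weights ln p / p (sums \<open>A\<close>) to the weights 1 / p
  (sums \<open>B\<close>). A new prime does not change the difference B - A / ln, taken at its own
  logarithm, so from n to n + 1 this difference grows by exactly A n * (1 / ln n - 1 / ln (n +
  1)).\<close>

lemma log_density_sum_inverse:
  assumes "log_density P \<kappa>" and "\<kappa> > 0"
  obtains E where "E \<ge> 0" "\<And>n. n \<ge> 2 \<Longrightarrow> \<kappa> * ln (ln (real n + 1)) - E \<le> (\<Sum>p | p \<in> P \<and> p \<le> n. 1 / real p)"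
proof -
  obtain E0 where E0: "\<And>n. n \<ge> 1 \<Longrightarrow> \<bar>(\<Sum>p | p \<in> P \<and> p \<le> n. ln (real p) / real p) - \<kappa> * ln (real n)\<bar> \<le> E0"
    using assms(1) unfolding log_density_def by blast
  have "E0 \<ge> 0" using E0[of 1] by (meson abs_ge_zero order_trans order_refl)
  have primes: "\<And>p. p \<in> P \<Longrightarrow> p \<ge> 2" using assms(1) prime_ge_2_nat unfolding log_density_def by blast
  define A where "A n = (\<Sum>p | p \<in> P \<and> p \<le> n. ln (real p) / real p)" for n
  define B where "B n = (\<Sum>p | p \<in> P \<and> p \<le> n. 1 / real p)" for n
  have Suc: "A (Suc n) = A n + (if Suc n \<in> P then ln (real (Suc n)) / real (Suc n) else 0)"
    "B (Suc n) = B n + (if Suc n \<in> P then 1 / real (Suc n) else 0)" for n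
  proof -
    have "{p. p \<in> P \<and> p \<le> Suc n} = (if Suc n \<in> P then insert (Suc n) {p. p \<in> P \<and> p \<le> n} else {p. p \<in> P \<and> p \<le> n})"
      by (auto simp: le_Suc_eq)
    then show "A (Suc n) = A n + (if Suc n \<in> P then ln (real (Suc n)) / real (Suc n) else 0)"
      "B (Suc n) = B n + (if Suc n \<in> P then 1 / real (Suc n) else 0)"
      by (auto simp: A_def B_def finite_members_le)
  qed
  \<comment> \<open>The argument is n + 1, not n: with a, b, c the logarithms of n, n + 1, n + 2,
    the available increment (b - a) / b is at most ln b - ln a, but by concavity of ln it dominates
    ln c - ln b. The terms with E0 telescope.\<close>
  have "\<kappa> * (ln (ln (real n + 1)) - ln (ln 3)) - E0 * (1 / ln 2 - 1 / ln (real n)) \<le> B n - A n / ln (real n)"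
    if "n \<ge> 2" for n
    using that
  proof (induction n rule: dec_induct)
    case base
    have "{p. p \<in> P \<and> p \<le> 2} = (if 2 \<in> P then {2} else {})" using primes by force
    then show ?case by (simp add: A_def B_def)
  next
    case (step n)
    define a b c where "a = ln (real n)" "b = ln (real n + 1)" "c = ln (real n + 2)"
    have pos: "0 < a" "a < b" "b < c" using step by (auto simp: a_b_c_def)
    have "c + a \<le> 2 * b"
    proof -
      have "c + a = ln ((real n + 2) * real n)" using step by (simp add: a_b_c_def ln_mult)
      also have "\<dots> \<le> ln ((real n + 1) * (real n + 1))"
      proof (rule ln_mono)
        show "(real n + 2) * real n > 0" using step by simp
      qed (simp add: algebra_simps)
      also have "\<dots> = 2 * b" by (subst ln_mult) (auto simp: a_b_c_def)
      finally show ?thesis .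
    qed
    have "ln c - ln b = ln (c / b)" using pos by (simp add: ln_div)
    also have "\<dots> \<le> c / b - 1" using pos by (intro ln_le_minus_one) auto
    also have "\<dots> = (c - b) / b" using pos by (simp add: field_simps)
    also have "\<dots> \<le> (b - a) / b" using pos \<open>c + a \<le> 2 * b\<close> by (intro divide_right_mono) auto
    finally have lnln: "ln c - ln b \<le> (b - a) / b" .
    have "(\<kappa> * a - E0) * (1 / a - 1 / b) \<le> A n * (1 / a - 1 / b)"
      using E0[of n] step pos by (intro mult_right_mono) (auto simp: A_def a_b_c_def field_simps abs_le_iff)
    moreover have "(\<kappa> * a - E0) * (1 / a - 1 / b) = \<kappa> * ((b - a) / b) - E0 * (1 / a - 1 / b)"
      using pos by (simp add: field_simps)
    moreover have "\<kappa> * (ln c - ln b) \<le> \<kappa> * ((b - a) / b)"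
      using lnln \<open>\<kappa> > 0\<close> by (intro mult_left_mono) auto
    ultimately have inc: "\<kappa> * (ln c - ln b) - E0 * (1 / a - 1 / b) \<le> A n * (1 / a - 1 / b)" by linarith
    have "B (Suc n) - A (Suc n) / ln (real (Suc n)) = B n - A n / b"
      using pos step(1) by (simp add: Suc a_b_c_def add_divide_distrib add.commute)
    also have "\<dots> = (B n - A n / a) + A n * (1 / a - 1 / b)" by (simp add: algebra_simps)
    finally have eq: "B (Suc n) - A (Suc n) / ln (real (Suc n)) = (B n - A n / a) + A n * (1 / a - 1 / b)" .
    have "\<kappa> * (ln b - ln (ln 3)) - E0 * (1 / ln 2 - 1 / a) \<le> B n - A n / a"
      using step.IH by (simp add: a_b_c_def)
    then have "\<kappa> * (ln c - ln (ln 3)) - E0 * (1 / ln 2 - 1 / b) \<le> (B n - A n / a) + A n * (1 / a - 1 / b)"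
      using inc by (simp add: algebra_simps)
    moreover have "ln (real (Suc n) + 1) = c" "ln (real (Suc n)) = b" by (simp_all add: a_b_c_def add_ac)
    ultimately show ?case unfolding eq by (simp only:)
  qed note main = this
  have "\<kappa> * ln (ln (real n + 1)) - (E0 / ln 2 + \<kappa> * \<bar>ln (ln 3)\<bar>) \<le> B n" if "n \<ge> 2" for n
  proof -
    have "A n / ln (real n) \<ge> 0"
      unfolding A_def using that primes by (intro divide_nonneg_nonneg sum_nonneg) (force intro!: divide_nonneg_nonneg ln_ge_zero)+
    moreover have "E0 * (1 / ln 2 - 1 / ln (real n)) \<le> E0 / ln 2"
      using \<open>E0 \<ge> 0\<close> that by (simp add: right_diff_distrib)
    moreover have "\<kappa> * ln (ln 3) \<le> \<kappa> * \<bar>ln (ln 3)\<bar>" using \<open>\<kappa> > 0\<close> by (intro mult_left_mono) auto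
    ultimately show ?thesis using main[OF that] by (simp add: right_diff_distrib)
  qed
  moreover have "E0 / ln 2 + \<kappa> * \<bar>ln (ln 3)\<bar> \<ge> 0" using \<open>E0 \<ge> 0\<close> \<open>\<kappa> > 0\<close> by simp
  ultimately show ?thesis using that unfolding B_def by blast
qed

text \<open>The errors at n and n / K add up to at most 2E, so once \<kappa> ln K \<ge> 2E + 1 the
  members of P between n / K and n carry a mass of at least 1. Each such p has ln p / p \<le> (K /
  n) ln p, which gives c = 1 / K.\<close>

lemma log_density_theta:
  assumes "log_density P \<kappa>" and "\<kappa> > 0"
  obtains c n0 where "c > 0" "n0 \<ge> 2" "\<And>n. n \<ge> n0 \<Longrightarrow> c * real n \<le> (\<Sum>p | p \<in> P \<and> p \<le> n. ln (real p))"
proof -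
  obtain E where E: "\<And>n. n \<ge> 1 \<Longrightarrow> \<bar>(\<Sum>p | p \<in> P \<and> p \<le> n. ln (real p) / real p) - \<kappa> * ln (real n)\<bar> \<le> E"
    using assms(1) unfolding log_density_def by blast
  have primes: "\<And>p. p \<in> P \<Longrightarrow> p \<ge> 2" using assms(1) prime_ge_2_nat unfolding log_density_def by blast
  define K where "K = nat \<lceil>exp ((2 * E + 1) / \<kappa>)\<rceil> + 2"
  have K2: "K \<ge> 2" by (simp add: K_def)
  have "exp ((2 * E + 1) / \<kappa>) \<le> real K" unfolding K_def by linarith
  then have "(2 * E + 1) / \<kappa> \<le> ln (real K)"
    using K2 by (subst ln_ge_iff) auto
  then have K: "2 * E + 1 \<le> \<kappa> * ln (real K)" using \<open>\<kappa> > 0\<close> by (simp add: field_simps)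
  have "1 / real K * real n \<le> (\<Sum>p | p \<in> P \<and> p \<le> n. ln (real p))" if "n \<ge> K" for n
  proof -
    define m where "m = n div K"
    have m: "m \<ge> 1" "m * K \<le> n" "n < (m + 1) * K"
      using that K2 by (auto simp: m_def Suc_le_eq div_greater_zero_iff dividend_less_div_times)
    have n: "real n > 0" using that K2 by simp
    have mK: "real m * real K \<le> real n" "real n < (real m + 1) * real K"
      using m(2,3) by (metis of_nat_le_iff of_nat_mult) (use m(3) in \<open>metis of_nat_1 of_nat_add of_nat_less_iff of_nat_mult\<close>)
    have "ln (real m) + ln (real K) = ln (real m * real K)" using m K2 by (simp add: ln_mult)
    also have "\<dots> \<le> ln (real n)" using mK m K2 n by (intro ln_mono) auto
    finally have "\<kappa> * (ln (real m) + ln (real K)) \<le> \<kappa> * ln (real n)" using \<open>\<kappa> > 0\<close> by (intro mult_left_mono) auto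
    then have "1 \<le> (\<Sum>p | p \<in> P \<and> p \<le> n. ln (real p) / real p) - (\<Sum>p | p \<in> P \<and> p \<le> m. ln (real p) / real p)"
      using E[of n] E[of m] m K that K2 by (simp add: distrib_left abs_le_iff)
    also have "\<dots> = (\<Sum>p\<in>{p. p \<in> P \<and> p \<le> n} - {p. p \<in> P \<and> p \<le> m}. ln (real p) / real p)"
      using m K2 by (subst sum_diff) (auto simp: finite_members_le m_def intro: order_trans[OF _ div_le_dividend])
    also have "\<dots> \<le> (\<Sum>p\<in>{p. p \<in> P \<and> p \<le> n} - {p. p \<in> P \<and> p \<le> m}. ln (real p) * (real K / real n))"
    proof (rule sum_mono)
      fix p assume p: "p \<in> {p. p \<in> P \<and> p \<le> n} - {p. p \<in> P \<and> p \<le> m}"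
      then have "p \<ge> 2" "p \<ge> m + 1" using primes by auto
      then have "real n \<le> real p * real K"
        using mK(2) mult_right_mono[of "real m + 1" "real p" "real K"] by simp
      then have "1 / real p \<le> real K / real n" using \<open>p \<ge> 2\<close> n by (simp add: field_simps)
      then have "ln (real p) * (1 / real p) \<le> ln (real p) * (real K / real n)"
        using \<open>p \<ge> 2\<close> by (intro mult_left_mono) auto
      then show "ln (real p) / real p \<le> ln (real p) * (real K / real n)" by simp
    qed
    also have "\<dots> \<le> (\<Sum>p | p \<in> P \<and> p \<le> n. ln (real p) * (real K / real n))"
      using primes by (intro sum_mono2) (auto simp: finite_members_le intro!: mult_nonneg_nonneg ln_ge_zero dest!: primes)
    also have "\<dots> = (\<Sum>p | p \<in> P \<and> p \<le> n. ln (real p)) * (real K / real n)" by (rule sum_distrib_right[symmetric])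
    finally show ?thesis using n K2 by (simp add: field_simps)
  qed
  then show ?thesis using that[of "1 / real K" K] K2 by auto
qed

text \<open>Serves twice: as a sieve weight for k sieving elements and primes outside T, and with k
  = 1 and primes in T as a bound for the sum of 1 / q over q in Q(T). With L = ln N the sum of k / p
  over p \<le> exp (L^(1 - \<gamma>)) is nearly k \<kappa> ln L, and for m just below that value a
  single symmetric sum is nearly as large as exp of it. As m has order ln L, y^(3m) stays below
  N.\<close>

lemma eventually_esym_log_density:
  assumes P: "log_density P \<kappa>" and "\<kappa> > 0" and k: "k \<ge> (1::real)" and \<delta>: "0 < \<delta>" "\<delta> < k * \<kappa>"
  shows "\<forall>\<^sub>F N in sequentially. \<exists>m y::nat. y ^ (3 * m) \<le> N \<and>
    ln (real N) powr (k * \<kappa> - \<delta>) \<le> (\<Sum>X | X \<subseteq> {p\<in>P. p0 < p \<and> p \<le> y} \<and> card X = m. \<Prod>p\<in>X. k / real p)"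
proof -
  obtain E where "E \<ge> 0" and E: "\<And>n. n \<ge> 2 \<Longrightarrow> \<kappa> * ln (ln (real n + 1)) - E \<le> (\<Sum>p | p \<in> P \<and> p \<le> n. 1 / real p)"
    by (rule log_density_sum_inverse[OF P \<open>\<kappa> > 0\<close>]) blast
  define a where "a = k * \<kappa>"
  \<comment> \<open>The loss a * \<gamma> * ln L = (\<delta> / 8) ln L occurs twice, once through
    the choice of y and once through the term m * \<gamma> in \<open>esym_lower_bound\<close>. Since
    U uses a - \<delta> / 2, another \<delta> / 4 is left to absorb E1.\<close>
  define \<gamma> where "\<gamma> = \<delta> / (8 * a)"
  have a: "0 < a" "\<delta> < a" using assms by (auto simp: a_def)
  have \<gamma>: "0 < \<gamma>" "\<gamma> < 1 / 8" "a * \<gamma> = \<delta> / 8" using a \<delta> by (auto simp: \<gamma>_def field_simps)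
  \<comment> \<open>Beyond p1 each summand k / p is at most \<gamma>, which then serves as the bound
    \<open>H\<close> of \<open>esym_lower_bound\<close>.\<close>
  define p1 where "p1 = max p0 (nat \<lceil>k / \<gamma>\<rceil>)"
  have p1: "k / real p \<le> \<gamma>" if "p > p1" for p
  proof -
    have "k / \<gamma> \<le> real p" using that unfolding p1_def by linarith
    moreover have "p > 0" using that by simp
    ultimately show ?thesis using \<gamma> by (simp add: field_simps)
  qed
  define E1 where "E1 = k * (E + (\<Sum>p | p \<in> P \<and> p \<le> p1. 1 / real p))"
  have "\<forall>\<^sub>F L in at_top. L > 1 \<and> exp (L powr (1 - \<gamma>)) \<ge> 3 \<and> (a - \<delta> / 2) * ln L \<ge> 1 \<and>
      3 * ((a - \<delta> / 2) * ln L) * L powr (1 - \<gamma>) \<le> L \<and>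
      (a - \<delta> / 2) * ln L \<le> (a - \<delta> / 4) * ln L - E1 \<and>
      L powr (a - \<delta>) \<le> exp ((a - \<delta> / 2) * ln L - 2) / ((a - \<delta> / 2) * ln L)"
    (is "eventually ?good at_top")
  proof (intro eventually_conj)
    show "\<forall>\<^sub>F L::real in at_top. L > 1" by real_asymp
    show "\<forall>\<^sub>F L in at_top. exp (L powr (1 - \<gamma>)) \<ge> 3" using \<gamma> by real_asymp
    have d: "a - \<delta> / 2 > 0" using a \<delta> by simp
    show "\<forall>\<^sub>F L in at_top. (a - \<delta> / 2) * ln L \<ge> 1" using d by real_asymp
    show "\<forall>\<^sub>F L in at_top. 3 * ((a - \<delta> / 2) * ln L) * L powr (1 - \<gamma>) \<le> L" using d \<gamma> by real_asymp
    have "\<forall>\<^sub>F L in at_top. E1 \<le> (\<delta> / 4) * ln L" using \<delta> by real_asymp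
    then show "\<forall>\<^sub>F L in at_top. (a - \<delta> / 2) * ln L \<le> (a - \<delta> / 4) * ln L - E1"
      by eventually_elim (simp add: algebra_simps)
    have "\<forall>\<^sub>F L in at_top. (a - \<delta>) * ln L \<le> (a - \<delta> / 2) * ln L - 2 - ln ((a - \<delta> / 2) * ln L)"
      using d \<delta> by real_asymp
    then show "\<forall>\<^sub>F L in at_top. L powr (a - \<delta>) \<le> exp ((a - \<delta> / 2) * ln L - 2) / ((a - \<delta> / 2) * ln L)"
      using eventually_gt_at_top[of 1]
    proof eventually_elim
      case (elim L)
      have "exp ((a - \<delta>) * ln L) \<le> exp ((a - \<delta> / 2) * ln L - 2 - ln ((a - \<delta> / 2) * ln L))"
        using elim by simp
      then show ?case using elim d by (simp add: powr_def exp_diff)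
    qed
  qed
  moreover have "filterlim (\<lambda>N. ln (real N)) at_top sequentially" by real_asymp
  ultimately have "\<forall>\<^sub>F N in sequentially. ?good (ln (real N))" by (rule eventually_compose_filterlim)
  then show ?thesis using eventually_gt_at_top[of 0]
  proof eventually_elim
    case (elim N)
    define L where "L = ln (real N)"
    have good: "?good L" using elim(1) by (simp only: L_def)
    define U where "U = (a - \<delta> / 2) * ln L"
    define m where "m = nat \<lfloor>U\<rfloor>"
    define y where "y = nat \<lfloor>exp (L powr (1 - \<gamma>))\<rfloor>"
    define R where "R = {p\<in>P. p1 < p \<and> p \<le> y}"
    have U: "U \<ge> 1" "real m \<le> U" using good by (auto simp: U_def m_def)
    have y: "y \<ge> 2" "real y \<le> exp (L powr (1 - \<gamma>))" "exp (L powr (1 - \<gamma>)) \<le> real y + 1"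
      using good unfolding y_def by linarith+
    have finR: "finite R" unfolding R_def by (rule finite_subset[of _ "{..y}"]) auto
    have "real (y ^ (3 * m)) \<le> exp (L powr (1 - \<gamma>)) ^ (3 * m)"
      using y by (simp add: power_mono)
    also have "\<dots> = exp (real (3 * m) * L powr (1 - \<gamma>))" by (rule exp_of_nat_mult[symmetric])
    also have "\<dots> \<le> exp (3 * U * L powr (1 - \<gamma>))"
      using U by (simp add: mult_right_mono)
    also have "\<dots> \<le> exp L" using good by (simp add: U_def)
    also have "\<dots> = real N" using elim by (simp add: L_def)
    finally have le_N: "y ^ (3 * m) \<le> N" by (simp only: of_nat_le_iff)
    have "(1 - \<gamma>) * ln L = ln (ln (exp (L powr (1 - \<gamma>))))" using good by (simp add: ln_powr)
    also have "\<dots> \<le> ln (ln (real y + 1))"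
      using y good by (intro ln_mono) auto
    finally have "\<kappa> * ((1 - \<gamma>) * ln L) - E \<le> (\<Sum>p | p \<in> P \<and> p \<le> y. 1 / real p)"
      using E[OF y(1)] \<open>\<kappa> > 0\<close> by (smt (verit) mult_left_mono)
    also have "\<dots> \<le> (\<Sum>p\<in>R \<union> {p. p \<in> P \<and> p \<le> p1}. 1 / real p)"
      using finR by (intro sum_mono2) (auto simp: R_def finite_members_le)
    also have "\<dots> = (\<Sum>p\<in>R. 1 / real p) + (\<Sum>p | p \<in> P \<and> p \<le> p1. 1 / real p)"
      using finR by (intro sum.union_disjoint) (auto simp: R_def finite_members_le)
    finally have "k * (\<kappa> * ((1 - \<gamma>) * ln L)) \<le> k * ((\<Sum>p\<in>R. 1 / real p) + (E + (\<Sum>p | p \<in> P \<and> p \<le> p1. 1 / real p)))"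
      using k by (intro mult_left_mono) auto
    then have S: "a * (1 - \<gamma>) * ln L - E1 \<le> (\<Sum>p\<in>R. k / real p)"
      by (simp add: a_def E1_def algebra_simps sum_distrib_left)
    have "real m * \<gamma> \<le> U * \<gamma>" using U \<gamma> by (intro mult_right_mono) auto
    also have "\<dots> \<le> a * \<gamma> * ln L" using \<gamma> \<delta> good by (simp add: U_def mult_ac)
    finally have "real m * \<gamma> \<le> a * \<gamma> * ln L" .
    then have "(a - \<delta> / 4) * ln L - E1 \<le> (\<Sum>p\<in>R. k / real p) - real m * \<gamma>"
      using S unfolding right_diff_distrib left_diff_distrib \<gamma>(3) by (simp add: algebra_simps)
    then have SU: "U \<le> (\<Sum>p\<in>R. k / real p) - real m * \<gamma>" using good unfolding U_def by linarith
    have "ln (real N) powr (k * \<kappa> - \<delta>) \<le> exp (U - 2) / U"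
      using good by (simp add: L_def a_def U_def)
    also have "\<dots> \<le> U ^ m / fact m" unfolding m_def by (rule power_floor_div_fact_ge[OF U(1)])
    also have "\<dots> \<le> ((\<Sum>p\<in>R. k / real p) - real m * \<gamma>) ^ m / fact m"
      using SU U by (intro divide_right_mono power_mono) auto
    also have "\<dots> \<le> (\<Sum>X | X \<subseteq> R \<and> card X = m. \<Prod>p\<in>X. k / real p)"
      using finR p1 k \<gamma> SU U by (intro esym_lower_bound) (auto simp: R_def)
    also have "\<dots> \<le> (\<Sum>X | X \<subseteq> {p\<in>P. p0 < p \<and> p \<le> y} \<and> card X = m. \<Prod>p\<in>X. k / real p)"
      using k by (intro sum_mono2) (auto simp: R_def p1_def intro!: prod_nonneg)
    finally show ?case using le_N by blast
  qed
qed

section \<open>The counting function of integers with restricted prime factors\<close>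

lemma sum_ln_prime_factors_le:
  assumes "n > 0"
  shows "(\<Sum>p | prime p \<and> p dvd n. ln (real p)) \<le> ln (real n)"
proof -
  have "(\<Sum>p | prime p \<and> p dvd n. ln (real p)) = (\<Sum>p | prime p \<and> p dvd n. mangoldt p)"
    by (intro sum.cong) auto
  also have "\<dots> \<le> (\<Sum>d | d dvd n. mangoldt d :: real)"
    using assms by (intro sum_mono2) (auto intro: mangoldt_nonneg)
  also have "\<dots> = ln (real n)" using assms mangoldt_sum[of n, where ?'a = real] by simp
  finally show ?thesis .
qed

lemma prime_times_in_\<Q>: "m \<in> \<Q> T \<Longrightarrow> p \<in> T \<Longrightarrow> prime p \<Longrightarrow> m * p \<in> \<Q> T"
  unfolding \<Q>_def by (auto simp: prime_dvd_mult_iff prime_gt_0_nat dest: primes_dvd_imp_eq)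

lemma prod_primes_in_\<Q>:
  assumes "finite X" "X \<subseteq> T" "\<forall>p\<in>T. prime p"
  shows "\<Prod>X \<in> \<Q> T"
proof -
  have "\<Prod>X > 0" using assms by (intro prod_pos) (auto intro: prime_gt_0_nat)
  moreover have "q \<in> T" if q: "prime q" "q dvd \<Prod>X" for q
  proof -
    obtain p where "p \<in> X" "q dvd p" using prime_dvd_prod_iff[of X q "\<lambda>x. x"] assms(1) q by blast
    then show ?thesis using assms primes_dvd_imp_eq q by blast
  qed
  ultimately show ?thesis by (auto simp: \<Q>_def)
qed

text \<open>Pairs (m, p) weighted by ln p are grouped by n = m * p. For a given n the prime p
  determines m and divides n, so the weights attached to n add up to at most ln n.\<close>

lemma sum_theta_le_card_\<Q>:
  assumes T: "\<forall>p\<in>T. prime p" and "N > 0"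
    and M: "finite M" "M \<subseteq> \<Q> T"
  shows "(\<Sum>m\<in>M. \<Sum>p | p \<in> T \<and> p \<le> N div m. ln (real p)) \<le> real (card (\<Q> T \<inter> {..N})) * ln (real N)"
proof -
  let ?S = "SIGMA m:M. {p. p \<in> T \<and> p \<le> N div m}"
  have fin: "finite ?S" using M finite_members_le by blast
  have M_pos: "m > 0" if "m \<in> M" for m using M that by (auto simp: \<Q>_def)
  have "(\<Sum>m\<in>M. \<Sum>p | p \<in> T \<and> p \<le> N div m. ln (real p)) = (\<Sum>z\<in>?S. ln (real (snd z)))"
    using M finite_members_le by (subst sum.Sigma) (auto simp: case_prod_unfold)
  also have "\<dots> = (\<Sum>n\<in>\<Q> T \<inter> {..N}. \<Sum>z | z \<in> ?S \<and> fst z * snd z = n. ln (real (snd z)))"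
  proof (rule sum.group[symmetric, OF fin])
    show "(\<lambda>z. fst z * snd z) ` ?S \<subseteq> \<Q> T \<inter> {..N}"
    proof (rule image_subsetI)
      fix z assume "z \<in> ?S"
      then obtain m p where mp: "z = (m, p)" "m \<in> M" "p \<in> T" "p \<le> N div m" by blast
      have "m * p \<le> m * (N div m)" using mp by simp
      also have "\<dots> \<le> N" by simp
      finally show "fst z * snd z \<in> \<Q> T \<inter> {..N}" using mp M T prime_times_in_\<Q>[of m T p] by auto
    qed
  qed simp
  also have "\<dots> \<le> (\<Sum>n\<in>\<Q> T \<inter> {..N}. ln (real N))"
  proof (rule sum_mono)
    fix n assume n: "n \<in> \<Q> T \<inter> {..N}"
    then have n0: "n > 0" by (simp add: \<Q>_def)
    have "(\<Sum>z | z \<in> ?S \<and> fst z * snd z = n. ln (real (snd z))) = (\<Sum>p\<in>snd ` {z. z \<in> ?S \<and> fst z * snd z = n}. ln (real p))"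
    proof -
      have "inj_on snd {z. z \<in> ?S \<and> fst z * snd z = n}"
        using n0 by (auto simp: inj_on_def)
      then show ?thesis by (simp add: sum.reindex)
    qed
    also have "\<dots> \<le> (\<Sum>p | prime p \<and> p dvd n. ln (real p))"
      using T n0 prime_ge_1_nat by (intro sum_mono2) (auto intro!: ln_ge_zero simp: Suc_le_eq prime_gt_0_nat)
    also have "\<dots> \<le> ln (real n)" by (rule sum_ln_prime_factors_le[OF n0])
    also have "\<dots> \<le> ln (real N)" using n n0 by simp
    finally show "(\<Sum>z | z \<in> ?S \<and> fst z * snd z = n. ln (real (snd z))) \<le> ln (real N)" .
  qed
  finally show ?thesis by simp
qed

lemma esym_le_sum_\<Q>:
  assumes T: "\<forall>p\<in>T. prime p" and R: "R \<subseteq> T" "\<And>p. p \<in> R \<Longrightarrow> p \<le> y" and B: "y ^ m \<le> B"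
  shows "(\<Sum>X | X \<subseteq> R \<and> card X = m. \<Prod>p\<in>X. 1 / real p) \<le> (\<Sum>q\<in>\<Q> T \<inter> {..B}. 1 / real q)"
proof -
  let ?E = "{X. X \<subseteq> R \<and> card X = m}"
  have "finite R" using R by (intro finite_subset[of R "{..y}"]) auto
  then have fin: "finite X" if "X \<in> ?E" for X using that finite_subset by blast
  have "inj_on (\<lambda>X. \<Prod>X) ?E"
    using fin R T by (intro inj_on_prod_prime_sets) blast
  then have "(\<Sum>q\<in>(\<lambda>X. \<Prod>X) ` ?E. 1 / real q) = (\<Sum>X\<in>?E. 1 / real (\<Prod>X))"
    by (subst sum.reindex) (simp_all add: comp_def)
  also have "\<dots> = (\<Sum>X\<in>?E. \<Prod>p\<in>X. 1 / real p)"
    by (simp add: prod_dividef)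
  finally have "(\<Sum>X\<in>?E. \<Prod>p\<in>X. 1 / real p) = (\<Sum>q\<in>(\<lambda>X. \<Prod>X) ` ?E. 1 / real q)" ..
  also have "\<dots> \<le> (\<Sum>q\<in>\<Q> T \<inter> {..B}. 1 / real q)"
  proof (rule sum_mono2)
    show "(\<lambda>X. \<Prod>X) ` ?E \<subseteq> \<Q> T \<inter> {..B}"
    proof (rule image_subsetI)
      fix X assume X: "X \<in> ?E"
      have "\<Prod>X \<le> (\<Prod>p\<in>X. y)" using X R by (intro prod_mono) auto
      also have "\<dots> \<le> B" using X B by simp
      finally show "\<Prod>X \<in> \<Q> T \<inter> {..B}" using prod_primes_in_\<Q>[OF fin[OF X] _ T] X R(1) by blast
    qed
  qed auto
  finally show ?thesis .
qed

text \<open>Members n = q * p with q \<le> y^m \<le> N^(1/3) and p \<le> N / q a prime of T are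
  enough: each q contributes log weight of order N / q, so the total is N times the sum of 1 / q,
  and passing from log weights to cardinalities costs one logarithm.\<close>

lemma eventually_card_\<Q>_ge:
  assumes T: "log_density T \<tau>" and "\<tau> > 0" and \<delta>: "0 < \<delta>" "\<delta> < \<tau>"
  shows "\<forall>\<^sub>F N in sequentially. real N * ln (real N) powr (\<tau> - 1 - \<delta>) \<le> real (card (\<Q> T \<inter> {..N}))"
proof -
  obtain c n0 where "c > 0" "n0 \<ge> 2" and theta: "\<And>n. n \<ge> n0 \<Longrightarrow> c * real n \<le> (\<Sum>p | p \<in> T \<and> p \<le> n. ln (real p))"
    by (rule log_density_theta[OF T \<open>\<tau> > 0\<close>]) blast
  have primes: "\<forall>p\<in>T. prime p" using T by (simp add: log_density_def)
  have "\<forall>\<^sub>F N in sequentially. \<exists>m y::nat. y ^ (3 * m) \<le> N \<and>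
    ln (real N) powr (1 * \<tau> - \<delta> / 2) \<le> (\<Sum>X | X \<subseteq> {p\<in>T. 0 < p \<and> p \<le> y} \<and> card X = m. \<Prod>p\<in>X. 1 / real p)"
    using \<delta> \<open>\<tau> > 0\<close> by (intro eventually_esym_log_density[OF T]) auto
  moreover have "\<forall>\<^sub>F N in sequentially. ln (real N) powr (\<tau> - 1 - \<delta>) \<le> c / 2 * ln (real N) powr (\<tau> - \<delta> / 2) / ln (real N)"
    using \<open>c > 0\<close> \<delta> by real_asymp
  moreover have "\<forall>\<^sub>F N in sequentially. ln (real N) > 0" by real_asymp
  ultimately show ?thesis using eventually_ge_at_top[of "n0 ^ 2"]
  proof eventually_elim
    case (elim N)
    have N: "N > 0" using elim(4) \<open>n0 \<ge> 2\<close> by (metis gr0I le_zero_eq not_numeral_le_zero power_eq_0_iff)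
    obtain m y :: nat where y: "y ^ (3 * m) \<le> N"
      and low: "ln (real N) powr (\<tau> - \<delta> / 2) \<le> (\<Sum>X | X \<subseteq> {p\<in>T. 0 < p \<and> p \<le> y} \<and> card X = m. \<Prod>p\<in>X. 1 / real p)"
      using elim(1) by auto
    define B where "B = y ^ m"
    \<comment> \<open>Guarantees N div q \<ge> n0 for all q \<le> B, the range where
      \<open>theta\<close> is valid. It follows from B^3 \<le> N if B is at least n0, and from n0^2
      \<le> N otherwise.\<close>
    have "B * n0 \<le> N"
    proof (cases "n0 \<le> B")
      case True
      then have "B * n0 \<le> B * (B * B)" using \<open>n0 \<ge> 2\<close> by (intro mult_le_mono2) (metis le_trans le_square)
      also have "\<dots> = y ^ (3 * m)" by (simp add: B_def power_add[symmetric] mult_2 numeral_3_eq_3)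
      finally show ?thesis using y by simp
    next
      case False
      then have "B * n0 \<le> n0 ^ 2" by (simp add: power2_eq_square)
      then show ?thesis using elim(4) by simp
    qed
    define M where "M = \<Q> T \<inter> {..B}"
    have "ln (real N) powr (\<tau> - \<delta> / 2) \<le> (\<Sum>q\<in>M. 1 / real q)"
      unfolding M_def by (rule order_trans[OF low esym_le_sum_\<Q>[OF primes, where y = y]]) (auto simp: B_def)
    then have "c / 2 * real N * ln (real N) powr (\<tau> - \<delta> / 2) \<le> c / 2 * real N * (\<Sum>q\<in>M. 1 / real q)"
      using \<open>c > 0\<close> by (intro mult_left_mono) auto
    also have "\<dots> = (\<Sum>q\<in>M. c / 2 * (real N / real q))" by (simp add: sum_distrib_left)
    also have "\<dots> \<le> (\<Sum>q\<in>M. \<Sum>p | p \<in> T \<and> p \<le> N div q. ln (real p))"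
    proof (rule sum_mono)
      fix q assume "q \<in> M"
      then have q: "q > 0" "q \<le> B" by (auto simp: M_def \<Q>_def)
      have "n0 * q \<le> N" using q \<open>B * n0 \<le> N\<close> by (metis le_trans mult.commute mult_le_mono2)
      then have nq: "n0 \<le> N div q" using q by (simp add: less_eq_div_iff_mult_less_eq)
      have "N = (N div q) * q + N mod q" by simp
      then have "real N = real (N div q) * real q + real (N mod q)" by (metis of_nat_add of_nat_mult)
      moreover have "real (N mod q) \<le> real (N div q) * real q"
      proof -
        have "N mod q \<le> 1 * q" using q by (simp add: less_imp_le)
        also have "\<dots> \<le> (N div q) * q" using nq \<open>n0 \<ge> 2\<close> by (intro mult_le_mono1) simp
        finally show ?thesis by (metis of_nat_le_iff of_nat_mult)
      qed
      ultimately have "real N / real q \<le> 2 * real (N div q)" using q by (simp add: field_simps)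
      then have "c / 2 * (real N / real q) \<le> c / 2 * (2 * real (N div q))"
        using \<open>c > 0\<close> by (intro mult_left_mono) auto
      also have "\<dots> = c * real (N div q)" by simp
      also have "\<dots> \<le> (\<Sum>p | p \<in> T \<and> p \<le> N div q. ln (real p))" by (rule theta[OF nq])
      finally show "c / 2 * (real N / real q) \<le> (\<Sum>p | p \<in> T \<and> p \<le> N div q. ln (real p))" .
    qed
    also have "\<dots> \<le> real (card (\<Q> T \<inter> {..N})) * ln (real N)"
      by (rule sum_theta_le_card_\<Q>[OF primes N]) (auto simp: M_def)
    finally have "real N * (c / 2 * ln (real N) powr (\<tau> - \<delta> / 2) / ln (real N)) \<le> real (card (\<Q> T \<inter> {..N}))"
      using elim(3) by (simp add: field_simps)
    moreover have "real N * ln (real N) powr (\<tau> - 1 - \<delta>) \<le> real N * (c / 2 * ln (real N) powr (\<tau> - \<delta> / 2) / ln (real N))"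
      using elim(2) by (intro mult_left_mono) auto
    ultimately show ?case by linarith
  qed
qed

section \<open>A superadditivity inequality for sumsets\<close>

lemma card_sum_sections:
  assumes "finite (X :: ('a \<times> 'b) set)"
  shows "(\<Sum>b\<in>snd ` X. card {a. (a, b) \<in> X}) = card X"
proof -
  have "X = (\<lambda>(b, a). (a, b)) ` (SIGMA b:snd ` X. {a. (a, b) \<in> X})" by force
  moreover have "inj_on (\<lambda>(b, a). (a, b)) (SIGMA b:snd ` X. {a. (a, b) \<in> X})" by (auto simp: inj_on_def)
  ultimately have "card X = card (SIGMA b:snd ` X. {a. (a, b) \<in> X})" by (metis card_image)
  also have "\<dots> = (\<Sum>b\<in>snd ` X. card {a. (a, b) \<in> X})"
  proof (rule card_SigmaI)
    show "\<forall>b\<in>snd ` X. finite {a. (a, b) \<in> X}"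
    proof
      fix b
      have "{a. (a, b) \<in> X} \<subseteq> fst ` X" by force
      then show "finite {a. (a, b) \<in> X}" using assms finite_subset by blast
    qed
  qed (use assms in auto)
  finally show ?thesis ..
qed

text \<open>Discrete Loomis-Whitney inequality. The slice at c has at most u and at most p c * r c
  elements, hence at most the geometric mean of the two bounds; Cauchy-Schwarz over c then separates
  p from r.\<close>

lemma loomis_whitney:
  fixes X :: "('a \<times> 'b \<times> 'c) set"
  assumes "finite X"
  shows "card X ^ 2 \<le> card ((\<lambda>(a, b, c). (a, b)) ` X) * card ((\<lambda>(a, b, c). (b, c)) ` X) * card ((\<lambda>(a, b, c). (a, c)) ` X)"
proof -
  let ?AB = "(\<lambda>(a, b, c). (a, b)) ` X" and ?BC = "(\<lambda>(a, b, c). (b, c)) ` X" and ?AC = "(\<lambda>(a, b, c). (a, c)) ` X"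
  define Y where "Y = (\<lambda>(a, b, c). ((a, b), c)) ` X"
  define C where "C = snd ` Y"
  define u where "u = real (card ?AB)"
  define p where "p c = real (card {a. (a, c) \<in> ?AC})" for c
  define r where "r c = real (card {b. (b, c) \<in> ?BC})" for c
  have finY: "finite Y" using assms by (simp add: Y_def)
  have cardY: "card Y = card X" unfolding Y_def by (rule card_image) (auto simp: inj_on_def)
  have C: "C = snd ` ?AC" "C = snd ` ?BC" by (force simp: C_def Y_def)+
  have slice: "real (card {ab. (ab, c) \<in> Y}) \<le> sqrt u * (sqrt (p c) * sqrt (r c))" for c
  proof -
    let ?Z = "{ab. (ab, c) \<in> Y}"
    have "?Z \<subseteq> ?AB" by (force simp: Y_def)
    then have "real (card ?Z) \<le> u" unfolding u_def using assms by (simp add: card_mono)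
    have fin: "finite {a. (a, c) \<in> ?AC}" "finite {b. (b, c) \<in> ?BC}"
      using assms by (auto intro!: finite_subset[of "{a. (a, c) \<in> ?AC}" "fst ` ?AC"] finite_subset[of "{b. (b, c) \<in> ?BC}" "fst ` ?BC"] simp: image_iff)
    have "?Z \<subseteq> {a. (a, c) \<in> ?AC} \<times> {b. (b, c) \<in> ?BC}" by (force simp: Y_def)
    then have "card ?Z \<le> card ({a. (a, c) \<in> ?AC} \<times> {b. (b, c) \<in> ?BC})" using fin by (intro card_mono) auto
    then have "real (card ?Z) \<le> real (card ({a. (a, c) \<in> ?AC} \<times> {b. (b, c) \<in> ?BC}))" by (simp only: of_nat_le_iff)
    also have "\<dots> = p c * r c" by (simp only: p_def r_def card_cartesian_product of_nat_mult)
    finally have "real (card ?Z) \<le> p c * r c" .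
    then have "real (card ?Z) * real (card ?Z) \<le> u * (p c * r c)"
      using \<open>real (card ?Z) \<le> u\<close> by (intro mult_mono) (auto simp: u_def)
    then have "sqrt (real (card ?Z) * real (card ?Z)) \<le> sqrt (u * (p c * r c))" by (rule real_sqrt_le_mono)
    then show ?thesis by (simp add: real_sqrt_mult)
  qed
  have "real (card X) = (\<Sum>c\<in>C. real (card {ab. (ab, c) \<in> Y}))"
    by (simp only: C_def cardY[symmetric] card_sum_sections[OF finY, symmetric] of_nat_sum)
  also have "\<dots> \<le> (\<Sum>c\<in>C. sqrt u * (sqrt (p c) * sqrt (r c)))" by (intro sum_mono slice)
  also have "\<dots> = sqrt u * (\<Sum>c\<in>C. sqrt (p c) * sqrt (r c))" by (rule sum_distrib_left[symmetric])
  finally have "(real (card X))\<^sup>2 \<le> (sqrt u * (\<Sum>c\<in>C. sqrt (p c) * sqrt (r c)))\<^sup>2" by (intro power_mono) auto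
  also have "\<dots> = u * (\<Sum>c\<in>C. sqrt (p c) * sqrt (r c))\<^sup>2" by (simp add: power_mult_distrib u_def)
  also have "\<dots> \<le> u * ((\<Sum>c\<in>C. (sqrt (p c))\<^sup>2) * (\<Sum>c\<in>C. (sqrt (r c))\<^sup>2))"
    by (intro mult_left_mono Cauchy_Schwarz_ineq_sum) (simp add: u_def)
  also have "\<dots> = u * ((\<Sum>c\<in>C. p c) * (\<Sum>c\<in>C. r c))" by (simp add: p_def r_def)
  also have "(\<Sum>c\<in>C. p c) = real (card ?AC)"
    unfolding p_def C(1) by (simp only: card_sum_sections[OF finite_imageI[OF assms]] of_nat_sum[symmetric])
  also have "(\<Sum>c\<in>C. r c) = real (card ?BC)"
    unfolding r_def C(2) by (simp only: card_sum_sections[OF finite_imageI[OF assms]] of_nat_sum[symmetric])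
  finally have "(real (card X))\<^sup>2 \<le> real (card ?AB * card ?BC * card ?AC)" by (simp add: u_def mult_ac)
  then show ?thesis by (metis of_nat_le_iff of_nat_power)
qed

text \<open>
  Among the representations of a sum pick one minimising $2a + b$. Exchanging two coordinates with
  another minimal representation preserves the sum, so minimality forces the pairs of coordinates
  of the chosen triples to be determined by their sums.
\<close>

lemma card_sumset_three_sq_le:
  fixes A B C :: "nat set"
  assumes fin: "finite A" "finite B" "finite C"
  shows "card (A + B + C) ^ 2 \<le> card (A + B) * card (B + C) * card (A + C)"
proof -
  define rep where "rep s t \<longleftrightarrow> (case t of (a, b, c) \<Rightarrow> a \<in> A \<and> b \<in> B \<and> c \<in> C \<and> a + b + c = s)" for s t
  \<comment> \<open>The coefficients 2, 1, 0 of a, b, c are distinct, so once the sum of two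
    coordinates and the third coordinate are fixed, the rank determines the triple. Minimality of
    two chosen triples, used in both directions, makes the ranks agree.\<close>
  define rank where "rank t = (case t of (a, b, c) \<Rightarrow> 2 * a + b)" for t :: "nat \<times> nat \<times> nat"
  have "\<exists>t. rep s t \<and> (\<forall>t'. rep s t' \<longrightarrow> rank t \<le> rank t')" if "s \<in> A + B + C" for s
  proof -
    from that obtain a b c where "a \<in> A" "b \<in> B" "c \<in> C" "s = a + b + c"
      by (auto simp: set_plus_def)
    then have "rep s (a, b, c)" by (simp add: rep_def)
    then show ?thesis by (rule ex_has_least_nat)
  qed
  then obtain f where f: "\<And>s. s \<in> A + B + C \<Longrightarrow> rep s (f s)"
    "\<And>s t. s \<in> A + B + C \<Longrightarrow> rep s t \<Longrightarrow> rank (f s) \<le> rank t" by metis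
  define X where "X = f ` (A + B + C)"
  have finX: "finite X" unfolding X_def using fin by (simp add: finite_set_plus)
  have X: "a \<in> A" "b \<in> B" "c \<in> C" if "(a, b, c) \<in> X" for a b c
  proof -
    obtain s where s: "s \<in> A + B + C" "f s = (a, b, c)" using \<open>(a, b, c) \<in> X\<close> by (auto simp: X_def)
    show "a \<in> A" "b \<in> B" "c \<in> C" using f(1)[OF s(1)] s(2) by (auto simp: rep_def)
  qed
  have min: "2 * a + b \<le> 2 * a' + b'"
    if "(a, b, c) \<in> X" "a' \<in> A" "b' \<in> B" "c' \<in> C" "a' + b' + c' = a + b + c" for a b c a' b' c'
  proof -
    from that(1) obtain s where s: "s \<in> A + B + C" "f s = (a, b, c)" by (auto simp: X_def)
    then have "s = a + b + c" using f(1)[OF s(1)] by (simp add: rep_def)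
    then have "rep s (a', b', c')" using that by (simp add: rep_def)
    then show ?thesis using f(2)[OF s(1)] s(2) by (fastforce simp: rank_def)
  qed
  have "inj_on f (A + B + C)"
  proof (rule inj_onI)
    fix x y assume xy: "x \<in> A + B + C" "y \<in> A + B + C" "f x = f y"
    obtain a b c where "f x = (a, b, c)" by (metis prod_cases3)
    then show "x = y" using f(1)[OF xy(1)] f(1)[OF xy(2)] xy(3) by (simp add: rep_def)
  qed
  then have "card (A + B + C) = card X" by (simp add: X_def card_image)
  also have "card X ^ 2 \<le> card ((\<lambda>(a, b, c). (a, b)) ` X) * card ((\<lambda>(a, b, c). (b, c)) ` X) * card ((\<lambda>(a, b, c). (a, c)) ` X)"
    by (rule loomis_whitney[OF finX])
  also have "\<dots> \<le> card (A + B) * card (B + C) * card (A + C)"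
  proof (intro mult_le_mono)
    show "card ((\<lambda>(a, b, c). (a, b)) ` X) \<le> card (A + B)"
    proof (rule card_inj_on_le[of "\<lambda>(a, b). a + b"])
      show "inj_on (\<lambda>(a, b). a + b) ((\<lambda>(a, b, c). (a, b)) ` X)"
      proof (rule inj_onI, clarsimp)
        fix a b c a' b' c' assume h: "(a, b, c) \<in> X" "(a', b', c') \<in> X" "a + b = a' + b'"
        show "a = a' \<and> b = b'"
          using min[OF h(1), of a' b' c] min[OF h(2), of a b c'] X[OF h(1)] X[OF h(2)] h(3) by simp
      qed
    qed (use X fin in \<open>auto simp: finite_set_plus intro!: set_plus_intro\<close>)
    show "card ((\<lambda>(a, b, c). (b, c)) ` X) \<le> card (B + C)"
    proof (rule card_inj_on_le[of "\<lambda>(b, c). b + c"])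
      show "inj_on (\<lambda>(b, c). b + c) ((\<lambda>(a, b, c). (b, c)) ` X)"
      proof (rule inj_onI, clarsimp)
        fix a b c a' b' c' assume h: "(a, b, c) \<in> X" "(a', b', c') \<in> X" "b + c = b' + c'"
        show "b = b' \<and> c = c'"
          using min[OF h(1), of a b' c'] min[OF h(2), of a' b c] X[OF h(1)] X[OF h(2)] h(3) by simp
      qed
    qed (use X fin in \<open>auto simp: finite_set_plus intro!: set_plus_intro\<close>)
    show "card ((\<lambda>(a, b, c). (a, c)) ` X) \<le> card (A + C)"
    proof (rule card_inj_on_le[of "\<lambda>(a, c). a + c"])
      show "inj_on (\<lambda>(a, c). a + c) ((\<lambda>(a, b, c). (a, c)) ` X)"
      proof (rule inj_onI, clarsimp)
        fix a b c a' b' c' assume h: "(a, b, c) \<in> X" "(a', b', c') \<in> X" "a + c = a' + c'"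
        show "a = a' \<and> c = c'"
          using min[OF h(1), of a' b c'] min[OF h(2), of a b' c] X[OF h(1)] X[OF h(2)] h(3) by simp
      qed
    qed (use X fin in \<open>auto simp: finite_set_plus intro!: set_plus_intro\<close>)
  qed
  finally show ?thesis .
qed

section \<open>The size of summands\<close>

lemma shifts_not_dvd:
  assumes h: "\<And>u v. u \<in> U \<Longrightarrow> v \<in> V \<Longrightarrow> u + v \<ge> x0 \<Longrightarrow> u + v \<in> \<Q> T"
    and "R \<inter> T = {}" and "p \<in> R" "prime p" and "z \<in> U" "z \<ge> x0" "d \<in> V"
  shows "\<not> p dvd z + d"
proof
  assume "p dvd z + d"
  moreover have "z + d \<in> \<Q> T" using assms by (intro h) auto
  ultimately have "p \<in> T" using \<open>prime p\<close> by (auto simp: \<Q>_def)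
  then show False using assms by blast
qed

text \<open>A fixed D of k elements forbids k classes for every large prime of R, a sieve of
  dimension k \<kappa>, which saves (ln N)^(k \<kappa>) up to \<delta>.\<close>

lemma card_summand_few_residues:
  assumes R: "log_density R \<kappa>" and "\<kappa> > 0" and "R \<inter> T = {}"
    and h: "\<And>u v. u \<in> U \<Longrightarrow> v \<in> V \<Longrightarrow> u + v \<ge> x0 \<Longrightarrow> u + v \<in> \<Q> T"
    and D: "finite D" "D \<subseteq> V" "card D = k" "k \<ge> 1"
    and \<delta>: "0 < \<delta>" "\<delta> < real k * \<kappa>"
  shows "\<forall>\<^sub>F N in sequentially. real (card (U \<inter> {1..N})) \<le> real N * ln (real N) powr (\<delta> - real k * \<kappa>)"
proof -
  \<comment> \<open>Primes above every element of D see k distinct residues, so their weight is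
    exactly k / p.\<close>
  define p0 where "p0 = Max D"
  have primes: "prime p" if "p \<in> R" for p using R that by (auto simp: log_density_def)
  have "D \<noteq> {}" using D by auto
  have "\<forall>\<^sub>F N in sequentially. \<exists>m y::nat. y ^ (3 * m) \<le> N \<and>
    ln (real N) powr (real k * \<kappa> - \<delta> / 2) \<le> (\<Sum>X | X \<subseteq> {p\<in>R. p0 < p \<and> p \<le> y} \<and> card X = m. \<Prod>p\<in>X. real k / real p)"
    using \<delta> \<open>\<kappa> > 0\<close> D(4) by (intro eventually_esym_log_density[OF R]) auto
  moreover have "\<forall>\<^sub>F N in sequentially. real x0 + 7 * real N * ln (real N) powr (\<delta> / 2 - real k * \<kappa>) \<le> real N * ln (real N) powr (\<delta> - real k * \<kappa>)"
    using \<delta> by real_asymp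
  moreover have "\<forall>\<^sub>F N in sequentially. ln (real N) > 0" by real_asymp
  ultimately show ?thesis
  proof eventually_elim
    case (elim N)
    have N: "N > 0" using elim(3) by (cases "N = 0") auto
    obtain m y :: nat where y: "y ^ (3 * m) \<le> N"
      and low: "ln (real N) powr (real k * \<kappa> - \<delta> / 2) \<le> (\<Sum>X | X \<subseteq> {p\<in>R. p0 < p \<and> p \<le> y} \<and> card X = m. \<Prod>p\<in>X. real k / real p)"
      using elim(1) by auto
    define P where "P = {p\<in>R. p0 < p \<and> p \<le> y}"
    define Z where "Z = U \<inter> {x0..} \<inter> {1..N}"
    have finP: "finite P" unfolding P_def by (rule finite_subset[of _ "{..y}"]) auto
    have card_mod: "card ((\<lambda>d. d mod p) ` D) = k" if "p \<in> P" for p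
    proof -
      have "d < p" if "d \<in> D" for d
        using Max_ge[OF D(1) that] \<open>p \<in> P\<close> by (simp add: P_def p0_def)
      then have "inj_on (\<lambda>d. d mod p) D" by (simp add: inj_on_def)
      then show ?thesis using D(3) by (simp add: card_image)
    qed
    \<comment> \<open>Here y^m is at most N^(1/3), below the admissible level N^(2/5).\<close>
    have "y ^ (5 * m) \<le> y ^ (6 * m)" by (cases "y = 0"; cases "m = 0") (auto intro: power_increasing simp: zero_power)
    also have "\<dots> = (y ^ (3 * m)) ^ 2" by (simp add: power_mult[symmetric] mult.commute)
    also have "\<dots> \<le> N ^ 2" using y by (rule power_mono) simp
    finally have y': "y ^ (5 * m) \<le> N ^ 2" .
    have "real (card Z) * ln (real N) powr (real k * \<kappa> - \<delta> / 2) \<le>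
        real (card Z) * (\<Sum>X | X \<subseteq> P \<and> card X = m. \<Prod>p\<in>X. real k / real p)"
      using low unfolding P_def by (intro mult_left_mono) auto
    also have "(\<Sum>X | X \<subseteq> P \<and> card X = m. \<Prod>p\<in>X. real k / real p)
        = (\<Sum>X | X \<subseteq> P \<and> card X = m. \<Prod>p\<in>X. real (card ((\<lambda>d. d mod p) ` D)) / real p)"
      by (intro sum.cong prod.cong refl) (auto simp: card_mod subset_iff)
    also have "real (card Z) * \<dots> \<le> 7 * real N"
    proof (rule sieve_shifts[where y = y])
      show "Z \<subseteq> {1..N}" by (auto simp: Z_def)
      show "prime p \<and> p \<le> y" if "p \<in> P" for p using that primes by (auto simp: P_def)
      show "\<not> p dvd z + d" if "p \<in> P" "z \<in> Z" "d \<in> D" for p z d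
        using that D(2) primes by (intro shifts_not_dvd[OF h \<open>R \<inter> T = {}\<close>]) (auto simp: P_def Z_def)
    qed (use D \<open>D \<noteq> {}\<close> finP y' N in auto)
    finally have "real (card Z) * ln (real N) powr (real k * \<kappa> - \<delta> / 2) * ln (real N) powr (\<delta> / 2 - real k * \<kappa>)
        \<le> 7 * real N * ln (real N) powr (\<delta> / 2 - real k * \<kappa>)"
      by (intro mult_right_mono) auto
    then have Z: "real (card Z) \<le> 7 * real N * ln (real N) powr (\<delta> / 2 - real k * \<kappa>)"
      using elim(3) by (simp add: mult.assoc powr_add[symmetric])
    have "U \<inter> {1..N} \<subseteq> {..<x0} \<union> Z" by (auto simp: Z_def)
    then have "card (U \<inter> {1..N}) \<le> card ({..<x0} \<union> Z)" by (intro card_mono) (auto simp: Z_def)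
    also have "\<dots> \<le> x0 + card Z" using card_Un_le[of "{..<x0}" Z] by simp
    finally have "real (card (U \<inter> {1..N})) \<le> real x0 + real (card Z)" by linarith
    then show ?case using Z elim(2) by linarith
  qed
qed

lemma card_le_mult_summands:
  fixes S U V :: "nat set"
  assumes sub: "S \<inter> {x0..} \<subseteq> U + V" and "0 \<notin> U" "0 \<notin> V"
  shows "card (S \<inter> {..N}) \<le> x0 + card (U \<inter> {1..N}) * card (V \<inter> {1..N})"
proof -
  have "S \<inter> {..N} \<subseteq> {..<x0} \<union> (\<lambda>(u, v). u + v) ` ((U \<inter> {1..N}) \<times> (V \<inter> {1..N}))"
  proof
    fix s assume s: "s \<in> S \<inter> {..N}"
    show "s \<in> {..<x0} \<union> (\<lambda>(u, v). u + v) ` ((U \<inter> {1..N}) \<times> (V \<inter> {1..N}))"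
    proof (cases "s < x0")
      case False
      then have "s \<in> U + V" using s sub by auto
      then obtain u v where uv: "u \<in> U" "v \<in> V" "s = u + v" by (auto simp: set_plus_def)
      moreover have "u \<noteq> 0" "v \<noteq> 0" using uv assms by metis+
      ultimately show ?thesis using s by (auto simp: Suc_le_eq intro!: image_eqI[of _ _ "(u, v)"])
    qed simp
  qed
  then have "card (S \<inter> {..N}) \<le> card ({..<x0} \<union> (\<lambda>(u, v). u + v) ` ((U \<inter> {1..N}) \<times> (V \<inter> {1..N})))"
    by (intro card_mono) auto
  also have "\<dots> \<le> x0 + card ((\<lambda>(u, v). u + v) ` ((U \<inter> {1..N}) \<times> (V \<inter> {1..N})))"
    using card_Un_le[of "{..<x0}"] by (metis card_lessThan)
  also have "\<dots> \<le> x0 + card ((U \<inter> {1..N}) \<times> (V \<inter> {1..N}))"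
    by (intro add_left_mono card_image_le) auto
  finally show ?thesis by (simp add: card_cartesian_product)
qed

text \<open>With L = ln N, dividing the lower bound N L^(-\<kappa> - \<delta>) for Q(T) by the upper
  bound N L^(\<delta> - k \<kappa>) for U leaves L^((k - 1) \<kappa>) up to 3 \<delta>: one \<delta>
  from each estimate and one to absorb x0. Growth starts only at k = 2.\<close>

lemma card_summand_ge:
  assumes T: "log_density T (1 - \<kappa>)" and R: "log_density R \<kappa>" and \<kappa>: "0 < \<kappa>" "\<kappa> < 1" and "R \<inter> T = {}"
    and h: "\<And>u v. u \<in> U \<Longrightarrow> v \<in> V \<Longrightarrow> u + v \<ge> x0 \<Longrightarrow> u + v \<in> \<Q> T"
    and sub: "\<Q> T \<inter> {x0..} \<subseteq> U + V" and "0 \<notin> U" "0 \<notin> V"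
    and D: "finite D" "D \<subseteq> V" "card D = k" "k \<ge> 1"
    and \<delta>: "0 < \<delta>" "\<delta> < 1 - \<kappa>" "\<delta> < \<kappa>"
  shows "\<forall>\<^sub>F N in sequentially. ln (real N) powr ((real k - 1) * \<kappa> - 3 * \<delta>) \<le> real (card (V \<inter> {1..N}))"
proof -
  have "\<kappa> * 1 \<le> \<kappa> * real k" using \<kappa> D(4) by (intro mult_left_mono) auto
  then have "\<delta> < \<kappa> * real k" using \<delta> by linarith
  then have \<delta>k: "\<delta> < real k * \<kappa>" by (simp only: mult.commute)
  have "\<forall>\<^sub>F N in sequentially. real N * ln (real N) powr ((1 - \<kappa>) - 1 - \<delta>) \<le> real (card (\<Q> T \<inter> {..N}))"
    using \<kappa> \<delta> by (intro eventually_card_\<Q>_ge[OF T]) auto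
  moreover have "\<forall>\<^sub>F N in sequentially. real (card (U \<inter> {1..N})) \<le> real N * ln (real N) powr (\<delta> - real k * \<kappa>)"
    by (rule card_summand_few_residues[OF R \<kappa>(1) \<open>R \<inter> T = {}\<close> h D \<delta>(1) \<delta>k])
  moreover have "\<forall>\<^sub>F N in sequentially. real x0 + real N * ln (real N) powr (- \<kappa> - 2 * \<delta>) \<le> real N * ln (real N) powr (- \<kappa> - \<delta>)"
    using \<delta> by real_asymp
  moreover have "\<forall>\<^sub>F N in sequentially. ln (real N) > 0" by real_asymp
  ultimately show ?thesis
  proof eventually_elim
    case (elim N)
    define L where "L = ln (real N)"
    have L: "L > 0" using elim(4) by (simp add: L_def)
    have N: "real N > 0" using elim(4) by (cases "N = 0") auto
    have "real N * L powr (- \<kappa> - \<delta>) \<le> real (card (\<Q> T \<inter> {..N}))"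
      using elim(1) by (simp add: L_def)
    also have "\<dots> \<le> real (x0 + card (U \<inter> {1..N}) * card (V \<inter> {1..N}))"
      using card_le_mult_summands[OF sub \<open>0 \<notin> U\<close> \<open>0 \<notin> V\<close>] by (simp only: of_nat_le_iff)
    also have "\<dots> \<le> real x0 + real N * L powr (\<delta> - real k * \<kappa>) * real (card (V \<inter> {1..N}))"
      using elim(2) by (simp add: L_def mult_right_mono)
    finally have "real N * L powr (- \<kappa> - 2 * \<delta>) \<le> real N * (L powr (\<delta> - real k * \<kappa>) * real (card (V \<inter> {1..N})))"
      using elim(3) by (simp add: L_def mult.assoc)
    then have "L powr (- \<kappa> - 2 * \<delta>) \<le> L powr (\<delta> - real k * \<kappa>) * real (card (V \<inter> {1..N}))"
      using N by simp
    then have "L powr (real k * \<kappa> - \<delta>) * L powr (- \<kappa> - 2 * \<delta>)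
        \<le> L powr (real k * \<kappa> - \<delta>) * (L powr (\<delta> - real k * \<kappa>) * real (card (V \<inter> {1..N})))"
      by (intro mult_left_mono) auto
    also have "\<dots> = real (card (V \<inter> {1..N}))"
      using L by (simp add: mult.assoc[symmetric] powr_add[symmetric])
    also have "L powr (real k * \<kappa> - \<delta>) * L powr (- \<kappa> - 2 * \<delta>) = L powr ((real k - 1) * \<kappa> - 3 * \<delta>)"
      by (simp add: powr_add[symmetric] algebra_simps)
    finally show ?case by (simp add: L_def)
  qed
qed

lemma card_summand_superlogarithmic:
  assumes T: "log_density T (1 - \<kappa>)" and R: "log_density R \<kappa>" and \<kappa>: "0 < \<kappa>" "\<kappa> < 1" and "R \<inter> T = {}"
    and h: "\<And>u v. u \<in> U \<Longrightarrow> v \<in> V \<Longrightarrow> u + v \<ge> x0 \<Longrightarrow> u + v \<in> \<Q> T"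
    and sub: "\<Q> T \<inter> {x0..} \<subseteq> U + V" and "0 \<notin> U" "0 \<notin> V"
    and V: "x \<in> V" "y \<in> V" "x \<noteq> y"
  shows "\<forall>\<^sub>F N in sequentially. ln (real N) powr r \<le> real (card (V \<inter> {1..N}))"
proof -
  \<comment> \<open>The divisor 6 gives 3 * \<delta> \<le> \<kappa> / 2, so the exponent \<kappa> -
    3 * \<delta> obtained from two elements is positive.\<close>
  define \<delta> where "\<delta> = min \<kappa> (1 - \<kappa>) / 6"
  have \<delta>: "0 < \<delta>" "\<delta> < 1 - \<kappa>" "\<delta> < \<kappa>" "6 * \<delta> \<le> \<kappa>" "\<delta> < 1" using \<kappa> by (auto simp: \<delta>_def min_def)
  note ge = card_summand_ge[OF T R \<kappa> \<open>R \<inter> T = {}\<close> h sub \<open>0 \<notin> U\<close> \<open>0 \<notin> V\<close> _ _ _ _ \<delta>(1-3)]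
  have "infinite V"
  proof
    assume "finite V"
    have "\<forall>\<^sub>F N in sequentially. ln (real N) powr ((real 2 - 1) * \<kappa> - 3 * \<delta>) \<le> real (card (V \<inter> {1..N}))"
      using V by (intro ge[of "{x, y}"]) auto
    moreover have "\<forall>\<^sub>F N in sequentially. real (card V) < ln (real N) powr ((real 2 - 1) * \<kappa> - 3 * \<delta>)"
      using \<delta> by real_asymp
    ultimately have "\<forall>\<^sub>F N in sequentially. False"
    proof eventually_elim
      case (elim N)
      have "card (V \<inter> {1..N}) \<le> card V" using \<open>finite V\<close> by (intro card_mono) auto
      then have "real (card (V \<inter> {1..N})) \<le> real (card V)" by (simp only: of_nat_le_iff)
      then show False using elim by linarith
    qed
    then show False by simp
  qed
  \<comment> \<open>Makes (k - 1) * \<kappa> at least r + 3, where the 3 covers the loss 3 *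
    \<delta>.\<close>
  define k where "k = nat \<lceil>(r + 3) / \<kappa>\<rceil> + 1"
  obtain D where D: "D \<subseteq> V" "finite D" "card D = k" using \<open>infinite V\<close> infinite_arbitrarily_large by blast
  have "(r + 3) / \<kappa> \<le> real k - 1" unfolding k_def by linarith
  then have "r + 3 \<le> (real k - 1) * \<kappa>" using \<kappa> by (simp add: field_simps)
  then have r: "r \<le> (real k - 1) * \<kappa> - 3 * \<delta>" using \<delta> by linarith
  have "\<forall>\<^sub>F N in sequentially. ln (real N) powr ((real k - 1) * \<kappa> - 3 * \<delta>) \<le> real (card (V \<inter> {1..N}))"
    using D by (intro ge[of D]) (auto simp: k_def)
  moreover have "\<forall>\<^sub>F N in sequentially. ln (real N) \<ge> 1" by real_asymp
  ultimately show ?thesis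
  proof eventually_elim
    case (elim N)
    have "ln (real N) powr r \<le> ln (real N) powr ((real k - 1) * \<kappa> - 3 * \<delta>)"
      using r elim(2) by (intro powr_mono) auto
    then show ?case using elim(1) by linarith
  qed
qed

text \<open>The counting identity behind Gallagher's larger sieve.\<close>

lemma sum_inverse_card_residues_le:
  fixes D P :: "nat set"
  assumes D: "D \<subseteq> {1..N}" "D \<noteq> {}" and P: "finite P" "\<And>p. p \<in> P \<Longrightarrow> prime p"
  shows "(\<Sum>p\<in>P. 1 / real (card ((\<lambda>d. d mod p) ` D))) \<le> real (card P) / real (card D) + 2 * ln (real N)"
proof -
  have fin: "finite D" using D finite_subset by blast
  define n where "n = real (card D)"
  have n: "n > 0" using fin D by (simp add: n_def card_gt_0_iff)
  define e where "e p d d' = (if d mod p = d' mod p then 1 else 0 :: real)" for p d d' :: nat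
  \<comment> \<open>Cauchy-Schwarz over the occupied classes: few residues force many congruent
    pairs.\<close>
  have each: "n\<^sup>2 / real (card ((\<lambda>d. d mod p) ` D)) \<le> (\<Sum>d\<in>D. \<Sum>d'\<in>D. e p d d')" for p
  proof -
    let ?I = "(\<lambda>d. d mod p) ` D"
    define w where "w r = real (card {d \<in> D. d mod p = r})" for r
    have n_eq: "n = (\<Sum>r\<in>?I. w r)"
    proof -
      have "(\<Sum>r\<in>?I. \<Sum>d | d \<in> D \<and> d mod p = r. (1::real)) = (\<Sum>d\<in>D. 1)"
        by (rule sum.group) (use fin in auto)
      then show ?thesis by (simp add: n_def w_def)
    qed
    have "(\<Sum>d\<in>D. \<Sum>d'\<in>D. e p d d') = (\<Sum>d\<in>D. w (d mod p))"
    proof (rule sum.cong[OF refl])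
      fix d
      have "(\<Sum>d'\<in>D. e p d d') = (\<Sum>d'\<in>{d' \<in> D. d' mod p = d mod p}. 1)"
        unfolding e_def using fin by (subst sum.inter_filter) (auto intro!: sum.cong)
      then show "(\<Sum>d'\<in>D. e p d d') = w (d mod p)" by (simp add: w_def)
    qed
    also have "\<dots> = (\<Sum>r\<in>?I. \<Sum>d | d \<in> D \<and> d mod p = r. w (d mod p))"
      by (rule sum.group[symmetric]) (use fin in auto)
    also have "\<dots> = (\<Sum>r\<in>?I. (w r)\<^sup>2)"
      by (intro sum.cong refl) (simp add: w_def power2_eq_square)
    finally have sq: "(\<Sum>d\<in>D. \<Sum>d'\<in>D. e p d d') = (\<Sum>r\<in>?I. (w r)\<^sup>2)" .
    have "(\<Sum>r\<in>?I. w r * 1)\<^sup>2 \<le> (\<Sum>r\<in>?I. (w r)\<^sup>2) * (\<Sum>r\<in>?I. 1\<^sup>2)"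
      by (rule Cauchy_Schwarz_ineq_sum)
    then have "n\<^sup>2 \<le> (\<Sum>d\<in>D. \<Sum>d'\<in>D. e p d d') * real (card ?I)" by (simp add: n_eq sq)
    moreover have "real (card ?I) > 0" using fin D by (simp add: card_gt_0_iff)
    ultimately show ?thesis by (simp add: field_simps)
  qed
  \<comment> \<open>Distinct d and d' are congruent only modulo primes dividing their difference t
    \<le> N. As ln p \<ge> 1/2, there are at most 2 ln t of them.\<close>
  have pair: "(\<Sum>p\<in>P. e p d d') \<le> (if d = d' then real (card P) else 0) + 2 * ln (real N)" if "d \<in> D" "d' \<in> D" for d d'
  proof (cases "d = d'")
    case True
    have "N \<ge> 1" using D that by force
    then show ?thesis using True by (simp add: e_def)
  next
    case False
    define t where "t = max d d' - min d d'"
    have t: "t > 0" "t \<le> N" using False D that by (auto simp: t_def max_def min_def)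
    have dvd: "p dvd t" if "d mod p = d' mod p" for p
    proof (cases "d \<le> d'")
      case True
      then show ?thesis using mod_eq_dvd_iff_nat[OF True, of p] that by (simp add: t_def)
    next
      case False
      then have "d' \<le> d" by simp
      then show ?thesis using mod_eq_dvd_iff_nat[of d' d p] that by (simp add: t_def)
    qed
    have "(\<Sum>p\<in>P. e p d d') = real (card {p\<in>P. d mod p = d' mod p})"
      unfolding e_def using P(1) by (simp add: sum.If_cases Int_def)
    also have "\<dots> = 2 * (\<Sum>p | p \<in> P \<and> d mod p = d' mod p. 1 / 2)" by simp
    also have "\<dots> \<le> 2 * (\<Sum>p | p \<in> P \<and> d mod p = d' mod p. ln (real p))"
    proof (intro mult_left_mono sum_mono)
      fix p assume "p \<in> {p. p \<in> P \<and> d mod p = d' mod p}"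
      then have "p \<ge> 2" using P(2) prime_ge_2_nat by blast
      then have "ln 2 \<le> ln (real p)" by simp
      then show "1 / 2 \<le> ln (real p)" using ln_le_minus_one[of "1 / 2"] by (simp add: ln_div)
    qed simp
    also have "\<dots> \<le> 2 * (\<Sum>p | prime p \<and> p dvd t. ln (real p))"
      using P dvd t by (intro mult_left_mono sum_mono2) (auto dest: prime_ge_1_nat)
    also have "\<dots> \<le> 2 * ln (real t)" using sum_ln_prime_factors_le[OF t(1)] by simp
    also have "\<dots> \<le> 2 * ln (real N)" using t by simp
    finally show ?thesis using False by simp
  qed
  have "n\<^sup>2 * (\<Sum>p\<in>P. 1 / real (card ((\<lambda>d. d mod p) ` D))) \<le> (\<Sum>p\<in>P. \<Sum>d\<in>D. \<Sum>d'\<in>D. e p d d')"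
    using each by (auto simp: sum_distrib_left intro!: sum_mono)
  also have "\<dots> = (\<Sum>d\<in>D. \<Sum>d'\<in>D. \<Sum>p\<in>P. e p d d')"
    by (subst sum.swap, rule sum.cong[OF refl], rule sum.swap)
  also have "\<dots> \<le> (\<Sum>d\<in>D. \<Sum>d'\<in>D. (if d = d' then real (card P) else 0) + 2 * ln (real N))"
    by (intro sum_mono pair)
  also have "\<dots> = n * real (card P) + n\<^sup>2 * (2 * ln (real N))"
    using fin by (simp add: sum.distrib n_def power2_eq_square algebra_simps)
  also have "\<dots> = n\<^sup>2 * (real (card P) / n + 2 * ln (real N))"
    using n by (simp add: field_simps power2_eq_square)
  finally show ?thesis using n by (simp add: n_def)
qed

text \<open>By Cauchy-Schwarz the sums of \<nu> p and of 1 / \<nu> p multiply to at least (card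
  P)^2. With card P \<le> card D the larger sieve bounds the second sum by 3 ln N.\<close>

lemma sum_card_residues_ge:
  fixes D P :: "nat set"
  assumes D: "D \<subseteq> {1..N}" "D \<noteq> {}" and P: "finite P" "\<And>p. p \<in> P \<Longrightarrow> prime p \<and> p \<le> y"
    and "card P \<le> card D" and "1 \<le> ln (real N)" and "y > 0"
  shows "(real (card P))\<^sup>2 / (3 * ln (real N) * real y) \<le> (\<Sum>p\<in>P. real (card ((\<lambda>d. d mod p) ` D)) / real p)"
proof -
  define \<nu> where "\<nu> p = real (card ((\<lambda>d. d mod p) ` D))" for p
  have fin: "finite D" using D finite_subset by blast
  have \<nu>: "\<nu> p > 0" for p using fin D by (simp add: \<nu>_def card_gt_0_iff)
  have "(\<Sum>p\<in>P. 1 / \<nu> p) \<le> real (card P) / real (card D) + 2 * ln (real N)"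
    unfolding \<nu>_def using D P by (intro sum_inverse_card_residues_le) auto
  also have "real (card P) / real (card D) \<le> 1"
    using \<open>card P \<le> card D\<close> by (cases "card D = 0") auto
  finally have inv: "(\<Sum>p\<in>P. 1 / \<nu> p) \<le> 3 * ln (real N)" using \<open>1 \<le> ln (real N)\<close> by simp
  have "(real (card P))\<^sup>2 = (\<Sum>p\<in>P. sqrt (\<nu> p) * sqrt (1 / \<nu> p))\<^sup>2"
    using \<nu> by (simp add: real_sqrt_mult[symmetric] less_imp_neq[OF \<nu>, symmetric])
  also have "\<dots> \<le> (\<Sum>p\<in>P. (sqrt (\<nu> p))\<^sup>2) * (\<Sum>p\<in>P. (sqrt (1 / \<nu> p))\<^sup>2)"
    by (rule Cauchy_Schwarz_ineq_sum)
  also have "\<dots> = (\<Sum>p\<in>P. \<nu> p) * (\<Sum>p\<in>P. 1 / \<nu> p)"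
    using \<nu> by (simp add: less_imp_le)
  also have "\<dots> \<le> (\<Sum>p\<in>P. \<nu> p) * (3 * ln (real N))"
    using inv \<nu> by (intro mult_left_mono sum_nonneg) (auto intro: less_imp_le)
  finally have "(real (card P))\<^sup>2 / (3 * ln (real N) * real y) \<le> (\<Sum>p\<in>P. \<nu> p) * (3 * ln (real N)) / (3 * ln (real N) * real y)"
    using \<open>1 \<le> ln (real N)\<close> by (intro divide_right_mono) auto
  also have "\<dots> = (\<Sum>p\<in>P. \<nu> p / real y)"
    using \<open>1 \<le> ln (real N)\<close> by (simp add: sum_divide_distrib)
  also have "\<dots> \<le> (\<Sum>p\<in>P. \<nu> p / real p)"
    using P \<nu> by (intro sum_mono divide_left_mono) (auto intro: less_imp_le simp: prime_gt_0_nat \<open>y > 0\<close>)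
  finally show ?thesis by (simp add: \<nu>_def)
qed

text \<open>With L = ln N, the choice of y near L^36 ensures card P \<le> card D. The residue sum S
  is then at least of order L^35 / (ln L)^2, which beats L^34 + L. The level condition y^(5m) \<le>
  N^2 dictates m near L / (90 ln L). The sieve weight is about L^(33m), that is N^(33/90) up to
  powers of L, and 1 - 33/90 = 19/30 lies below 13/20.\<close>

lemma card_summand_power_saving:
  assumes R: "log_density R \<kappa>" and "\<kappa> > 0" and "R \<inter> T = {}"
    and h: "\<And>u v. u \<in> U \<Longrightarrow> v \<in> V \<Longrightarrow> u + v \<ge> x0 \<Longrightarrow> u + v \<in> \<Q> T"
    and V: "\<forall>\<^sub>F N in sequentially. ln (real N) powr 36 \<le> real (card (V \<inter> {1..N}))"
  shows "\<forall>\<^sub>F N in sequentially. real (card (U \<inter> {1..N})) \<le> real N powr (13 / 20)"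
proof -
  have primes: "prime p" if "p \<in> R" for p using R that by (auto simp: log_density_def)
  obtain c n0 where "c > 0" "n0 \<ge> 2" and theta: "\<And>n. n \<ge> n0 \<Longrightarrow> c * real n \<le> (\<Sum>p | p \<in> R \<and> p \<le> n. ln (real p))"
    by (rule log_density_theta[OF R \<open>\<kappa> > 0\<close>]) blast
  have "\<forall>\<^sub>F L in at_top. L \<ge> 3 \<and> L ^ 36 \<ge> real n0 + 1 \<and>
      L ^ 34 + L \<le> c\<^sup>2 * (L ^ 36 - 1) / ((36 * ln L)\<^sup>2 * (3 * L)) \<and>
      L / (90 * ln L) \<le> L \<and>
      real x0 + 7 * exp L * (L ^ 33 * exp (- (33 / 90) * L)) \<le> exp (13 / 20 * L)"
    (is "eventually ?good at_top")
  proof (intro eventually_conj)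
    show "\<forall>\<^sub>F L::real in at_top. L \<ge> 3" by real_asymp
    show "\<forall>\<^sub>F L::real in at_top. L ^ 36 \<ge> real n0 + 1" by real_asymp
    show "\<forall>\<^sub>F L in at_top. L ^ 34 + L \<le> c\<^sup>2 * (L ^ 36 - 1) / ((36 * ln L)\<^sup>2 * (3 * L))"
      using \<open>c > 0\<close> by real_asymp
    show "\<forall>\<^sub>F L::real in at_top. L / (90 * ln L) \<le> L" by real_asymp
    show "\<forall>\<^sub>F L in at_top. real x0 + 7 * exp L * (L ^ 33 * exp (- (33 / 90) * L)) \<le> exp (13 / 20 * L)"
      by real_asymp
  qed
  moreover have "filterlim (\<lambda>N. ln (real N)) at_top sequentially" by real_asymp
  ultimately have "\<forall>\<^sub>F N in sequentially. ?good (ln (real N))" by (rule eventually_compose_filterlim)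
  then show ?thesis using V eventually_gt_at_top[of 0]
  proof eventually_elim
    case (elim N)
    define L where "L = ln (real N)"
    have good: "?good L" using elim(1) by (simp only: L_def)
    have L: "L \<ge> 3" "ln L > 0" using good by auto
    define y where "y = nat \<lfloor>L ^ 36\<rfloor>"
    define m where "m = nat \<lfloor>L / (90 * ln L)\<rfloor>"
    define D where "D = V \<inter> {1..N}"
    define P where "P = {p. p \<in> R \<and> p \<le> y}"
    define Z where "Z = U \<inter> {x0..} \<inter> {1..N}"
    have y: "n0 \<le> y" "real y \<le> L ^ 36" "L ^ 36 - 1 \<le> real y" "y > 0"
      using good \<open>n0 \<ge> 2\<close> unfolding y_def by linarith+
    have N: "real N = exp L" using elim(3) by (simp add: L_def)
    have "L / (90 * ln L) \<ge> 0" using L by simp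
    then have m: "real m \<le> L / (90 * ln L)" "L / (90 * ln L) - 1 \<le> real m" "real m \<le> L"
      using good unfolding m_def by linarith+
    have P: "finite P" "\<And>p. p \<in> P \<Longrightarrow> prime p \<and> p \<le> y"
      using primes by (auto simp: P_def finite_members_le)
    have "card P \<le> card {1..y}"
      using P by (intro card_mono) (auto simp: Suc_le_eq prime_gt_0_nat)
    then have "real (card P) \<le> L ^ 36" using y(2) by simp
    also have "L ^ 36 \<le> real (card D)"
      using elim(2) L by (simp add: D_def L_def)
    finally have card_PD: "card P \<le> card D" by simp
    have "L ^ 36 > 0" using L by simp
    with \<open>L ^ 36 \<le> real (card D)\<close> have "card D > 0" by linarith
    then have "D \<noteq> {}" "finite D" by (auto simp: card_gt_0_iff)
    have ln_y: "ln (real y) \<le> 36 * ln L"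
    proof -
      have "ln (real y) \<le> ln (L ^ 36)" using y by (intro ln_mono) auto
      then show ?thesis using L by (simp add: ln_realpow)
    qed
    have "c * real y \<le> (\<Sum>p\<in>P. ln (real p))" using theta[OF y(1)] by (simp add: P_def)
    also have "\<dots> \<le> (\<Sum>p\<in>P. 36 * ln L)"
    proof (rule sum_mono)
      fix p assume "p \<in> P"
      then have "ln (real p) \<le> ln (real y)" using P(2) prime_gt_0_nat by (intro ln_mono) auto
      then show "ln (real p) \<le> 36 * ln L" using ln_y by linarith
    qed
    finally have "c * real y / (36 * ln L) \<le> real (card P)" using L by (simp add: field_simps)
    then have card_P: "(c * real y / (36 * ln L))\<^sup>2 \<le> (real (card P))\<^sup>2"
      using \<open>c > 0\<close> L by (intro power_mono) auto
    define S where "S = (\<Sum>p\<in>P. real (card ((\<lambda>d. d mod p) ` D)) / real p)"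
    have "L ^ 34 + L \<le> c\<^sup>2 * (L ^ 36 - 1) / ((36 * ln L)\<^sup>2 * (3 * L))" using good by blast
    also have "\<dots> \<le> c\<^sup>2 * real y / ((36 * ln L)\<^sup>2 * (3 * L))"
      using y L by (intro divide_right_mono mult_left_mono) auto
    also have "\<dots> = (c * real y / (36 * ln L))\<^sup>2 / (3 * L * real y)"
      using y L by (simp add: field_simps power2_eq_square)
    also have "\<dots> \<le> (real (card P))\<^sup>2 / (3 * ln (real N) * real y)"
      using card_P L by (simp add: L_def[symmetric] divide_right_mono)
    also have "\<dots> \<le> S"
      unfolding S_def using \<open>D \<noteq> {}\<close> P card_PD L y
      by (intro sum_card_residues_ge) (auto simp: D_def L_def)
    finally have S: "L ^ 34 + L \<le> S" .
    have "L ^ 34 \<ge> 0" using L by simp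
    define e where "e = (\<Sum>X | X \<subseteq> P \<and> card X = m. \<Prod>p\<in>X. real (card ((\<lambda>d. d mod p) ` D)) / real p)"
    \<comment> \<open>Rounding m down costs at most one factor L^33.\<close>
    have "exp (33 / 90 * L) / L ^ 33 = exp (33 * ((L / (90 * ln L) - 1) * ln L))"
    proof -
      have "33 * ((L / (90 * ln L) - 1) * ln L) = 33 / 90 * L - 33 * ln L"
        using L by (simp add: field_simps)
      moreover have "exp (33 * ln L) = L ^ 33"
        using L exp_of_nat_mult[of 33 "ln L"] by simp
      ultimately show ?thesis by (simp only: exp_diff)
    qed
    also have "\<dots> \<le> exp (33 * (real m * ln L))"
      using m L by (simp add: mult_right_mono)
    also have "\<dots> = (L ^ 33) ^ m"
    proof -
      have "exp (33 * (real m * ln L)) = exp (real (33 * m) * ln L)" by (simp add: mult_ac)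
      also have "\<dots> = L ^ (33 * m)" using L by (subst exp_of_nat_mult) simp
      finally show ?thesis by (simp add: power_mult)
    qed
    also have "\<dots> = (L ^ 34) ^ m / L ^ m"
    proof -
      have "(L ^ 34) ^ m = (L ^ 33) ^ m * L ^ m" by (simp add: power_mult_distrib[symmetric] flip: power_Suc2)
      then show ?thesis using L by simp
    qed
    \<comment> \<open>The extra L in the bound for S pays for subtracting m, and m! \<le> L^m is why
      the base drops from L^34 to L^33.\<close>
    also have "\<dots> \<le> (S - real m * 1) ^ m / fact m"
    proof (intro frac_le power_mono)
      show "L ^ 34 \<le> S - real m * 1" using S m by simp
      have "fact m \<le> real (m ^ m)" using fact_le_power[of m, where ?'a = real] by simp
      also have "\<dots> \<le> L ^ m" using m by (simp add: power_mono)
      finally show "fact m \<le> L ^ m" .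
      show "(S - real m * 1) ^ m \<ge> 0" using S m \<open>L ^ 34 \<ge> 0\<close> by (intro zero_le_power) linarith
    qed (use \<open>L ^ 34 \<ge> 0\<close> in auto)
    also have "\<dots> \<le> e"
      unfolding e_def S_def
    proof (rule esym_lower_bound[OF P(1)])
      fix p assume "p \<in> P"
      then have p: "p > 0" using P(2) prime_gt_0_nat by blast
      have "card ((\<lambda>d. d mod p) ` D) \<le> card {..<p}" using p by (intro card_mono) auto
      then show "0 \<le> real (card ((\<lambda>d. d mod p) ` D)) / real p \<and> real (card ((\<lambda>d. d mod p) ` D)) / real p \<le> 1"
        using p by simp
    next
      show "real m * 1 \<le> (\<Sum>p\<in>P. real (card ((\<lambda>d. d mod p) ` D)) / real p)"
        using S m \<open>L ^ 34 \<ge> 0\<close> unfolding S_def by linarith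
    qed simp
    finally have e: "exp (33 / 90 * L) / L ^ 33 \<le> e" .
    have level: "y ^ (5 * m) \<le> N ^ 2"
    proof -
      have "real (y ^ (5 * m)) \<le> (L ^ 36) ^ (5 * m)" using y by (simp add: power_mono)
      also have "\<dots> = L ^ (180 * m)" by (simp add: power_mult[symmetric])
      also have "\<dots> = exp (real (180 * m) * ln L)" using L by (subst exp_of_nat_mult) simp
      also have "\<dots> \<le> exp (2 * L)" using m(1) L by (simp add: field_simps)
      also have "\<dots> = real (N ^ 2)" by (simp add: N exp_double)
      finally show ?thesis by (simp only: of_nat_le_iff)
    qed
    have "real (card Z) * (exp (33 / 90 * L) / L ^ 33) \<le> real (card Z) * e" using e by (intro mult_left_mono) auto
    also have "\<dots> \<le> 7 * real N"
      unfolding e_def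
    proof (rule sieve_shifts[where y = y])
      show "\<not> p dvd z + d" if "p \<in> P" "z \<in> Z" "d \<in> D" for p z d
        using that primes by (intro shifts_not_dvd[OF h \<open>R \<inter> T = {}\<close>]) (auto simp: P_def Z_def D_def)
    qed (use P \<open>D \<noteq> {}\<close> \<open>finite D\<close> level elim(3) in \<open>auto simp: Z_def\<close>)
    finally have "real (card Z) * (exp (33 / 90 * L) / L ^ 33) * (L ^ 33 * exp (- (33 / 90) * L))
        \<le> 7 * real N * (L ^ 33 * exp (- (33 / 90) * L))"
      using L by (intro mult_right_mono) auto
    also have "real (card Z) * (exp (33 / 90 * L) / L ^ 33) * (L ^ 33 * exp (- (33 / 90) * L)) = real (card Z)"
      using L by (simp add: exp_minus field_simps)
    finally have Z: "real (card Z) \<le> 7 * exp L * (L ^ 33 * exp (- (33 / 90) * L))" by (simp only: N)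
    have "U \<inter> {1..N} \<subseteq> {..<x0} \<union> Z" by (auto simp: Z_def)
    then have "card (U \<inter> {1..N}) \<le> card ({..<x0} \<union> Z)" by (intro card_mono) (auto simp: Z_def)
    also have "\<dots> \<le> x0 + card Z" using card_Un_le[of "{..<x0}" Z] by simp
    finally have "real (card (U \<inter> {1..N})) \<le> real x0 + real (card Z)" by linarith
    also have "\<dots> \<le> exp (13 / 20 * L)" using Z good by linarith
    also have "\<dots> = real N powr (13 / 20)" using elim(3) by (simp add: powr_def L_def)
    finally show ?case .
  qed
qed

section \<open>Contradiction for three summands\<close>

theorem corollary2p5:
  fixes \<tau> C :: real and T :: "nat set"
  assumes "0 < \<tau>" and "\<tau> < 1"
    and "\<forall>p\<in>T. prime p"
    and "(\<lambda>x::real. (\<Sum>p\<in>{p\<in>T. real p \<le> x}. ln (real p) / real p) - (\<tau> * ln x + C))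
           \<in> o[at_top](\<lambda>_. 1)"
  shows "\<not> (\<exists>\<A> \<B> \<C> :: nat set.
            0 \<notin> \<A> \<and> 0 \<notin> \<B> \<and> 0 \<notin> \<C> \<and>
            at_least_two \<A> \<and> at_least_two \<B> \<and> at_least_two \<C> \<and>
            \<Q> T \<sim>\<^sub>\<infinity> \<A> + \<B> + \<C>)"
proof (intro notI, elim exE conjE)
  fix A B C' :: "nat set"
  assume zero: "0 \<notin> A" "0 \<notin> B" "0 \<notin> C'"
    and two: "at_least_two A" "at_least_two B" "at_least_two C'"
    and same: "\<Q> T \<sim>\<^sub>\<infinity> A + B + C'"
  from same obtain x0 where x0: "(A + B + C') \<inter> {x0..} = \<Q> T \<inter> {x0..}"
    unfolding eventually_same_def by blast
  define \<kappa> where "\<kappa> = 1 - \<tau>"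
  define R where "R = {p. prime p} - T"
  have \<kappa>: "0 < \<kappa>" "\<kappa> < 1" using assms by (auto simp: \<kappa>_def)
  have T\<tau>: "log_density T \<tau>" by (rule log_density_of_asymptotics[OF assms(3,4)])
  then have T: "log_density T (1 - \<kappa>)" by (simp add: \<kappa>_def)
  have R: "log_density R \<kappa>"
    unfolding R_def \<kappa>_def using assms(3) by (intro log_density_Diff log_density_primes T\<tau>) auto
  have RT: "R \<inter> T = {}" by (auto simp: R_def)
  \<comment> \<open>Applied three times, with U the sum of two of the sets and V the remaining
    one.\<close>
  have saving: "\<forall>\<^sub>F N in sequentially. real (card (U \<inter> {1..N})) \<le> real N powr (13 / 20)"
    if UV: "U + V = A + B + C'" and "0 \<notin> U" "0 \<notin> V" "at_least_two V" for U V
  proof -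
    have h: "u + v \<in> \<Q> T" if "u \<in> U" "v \<in> V" "u + v \<ge> x0" for u v
    proof -
      have "u + v \<in> A + B + C'" using that UV set_plus_intro by metis
      then show ?thesis using x0 that by blast
    qed
    have sub: "\<Q> T \<inter> {x0..} \<subseteq> U + V" using x0 UV by blast
    obtain x y where xy: "x \<in> V" "y \<in> V" "x \<noteq> y" using \<open>at_least_two V\<close> by (auto simp: at_least_two_def)
    have V: "\<forall>\<^sub>F N in sequentially. ln (real N) powr 36 \<le> real (card (V \<inter> {1..N}))"
      by (rule card_summand_superlogarithmic[OF T R \<kappa> RT h sub \<open>0 \<notin> U\<close> \<open>0 \<notin> V\<close> xy])
    show ?thesis by (rule card_summand_power_saving[OF R \<kappa>(1) RT h V])
  qed
  have pos: "0 \<notin> S + S'" if "0 \<notin> S" for S S' :: "nat set" using that by (auto simp: set_plus_def)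
  have "\<forall>\<^sub>F N in sequentially. real (card ((A + B) \<inter> {1..N})) \<le> real N powr (13 / 20)"
    using zero two by (intro saving[of "A + B" C'] pos) auto
  moreover have "\<forall>\<^sub>F N in sequentially. real (card ((B + C') \<inter> {1..N})) \<le> real N powr (13 / 20)"
    using zero two by (intro saving[of "B + C'" A] pos) (auto simp: add_ac)
  moreover have "\<forall>\<^sub>F N in sequentially. real (card ((A + C') \<inter> {1..N})) \<le> real N powr (13 / 20)"
    using zero two by (intro saving[of "A + C'" B] pos) (auto simp: add_ac)
  ultimately have "\<forall>\<^sub>F N in sequentially. real (card ((A + B) \<inter> {1..N})) \<le> real N powr (13 / 20) \<and>
      real (card ((B + C') \<inter> {1..N})) \<le> real N powr (13 / 20) \<and>
      real (card ((A + C') \<inter> {1..N})) \<le> real N powr (13 / 20)" by eventually_elim simp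
  \<comment> \<open>Sums of two elements up to N reach 2N, so the bounds for the pair sums are
    needed there.\<close>
  moreover have "filterlim (\<lambda>N::nat. 2 * N) at_top sequentially" by real_asymp
  ultimately have "\<forall>\<^sub>F N in sequentially. real (card ((A + B) \<inter> {1..2 * N})) \<le> real (2 * N) powr (13 / 20) \<and>
      real (card ((B + C') \<inter> {1..2 * N})) \<le> real (2 * N) powr (13 / 20) \<and>
      real (card ((A + C') \<inter> {1..2 * N})) \<le> real (2 * N) powr (13 / 20)"
    by (rule eventually_compose_filterlim)
  moreover have "\<forall>\<^sub>F N in sequentially. real N * ln (real N) powr (\<tau> - 1 - \<tau> / 2) \<le> real (card (\<Q> T \<inter> {..N}))"
    using assms(1) by (intro eventually_card_\<Q>_ge[OF T\<tau>]) auto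
  \<comment> \<open>The exponent 39/40 is half of 3 * 13/20. Being below 1, it loses against N times
    any fixed power of ln N.\<close>
  moreover have "\<forall>\<^sub>F N in sequentially. real x0 + real (2 * N) powr (39 / 40) < real N * ln (real N) powr (\<tau> - 1 - \<tau> / 2)"
    by real_asymp
  ultimately have "\<forall>\<^sub>F N::nat in sequentially. False"
  proof eventually_elim
    case (elim N)
    define A' B' C'' where "A' = A \<inter> {1..N}" "B' = B \<inter> {1..N}" "C'' = C' \<inter> {1..N}"
    have fin: "finite A'" "finite B'" "finite C''" by (auto simp: A'_B'_C''_def)
    define w where "w = real (2 * N) powr (13 / 20)"
    have pair: "real (card (S \<inter> {1..N} + S' \<inter> {1..N})) \<le> w"
      if "real (card ((S + S') \<inter> {1..2 * N})) \<le> w" for S S'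
    proof -
      have "S \<inter> {1..N} + S' \<inter> {1..N} \<subseteq> (S + S') \<inter> {1..2 * N}" by (force simp: set_plus_def)
      then have "card (S \<inter> {1..N} + S' \<inter> {1..N}) \<le> card ((S + S') \<inter> {1..2 * N})" by (intro card_mono) auto
      then show ?thesis using that by linarith
    qed
    have "(real (card (A' + B' + C'')))\<^sup>2 \<le> real (card (A' + B')) * real (card (B' + C'')) * real (card (A' + C''))"
      using card_sumset_three_sq_le[OF fin] by (metis of_nat_le_iff of_nat_mult of_nat_power)
    also have "\<dots> \<le> w * w * w"
      using elim(1) unfolding A'_B'_C''_def by (intro mult_mono pair) (auto simp: w_def)
    also have "\<dots> = (real (2 * N) powr (39 / 40))\<^sup>2"
      by (simp add: w_def power2_eq_square powr_add[symmetric])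
    finally have "real (card (A' + B' + C'')) \<le> real (2 * N) powr (39 / 40)" by (rule power2_le_imp_le) simp
    moreover have "card (\<Q> T \<inter> {..N}) \<le> x0 + card (A' + B' + C'')"
    proof -
      have "\<Q> T \<inter> {..N} \<subseteq> {..<x0} \<union> (A' + B' + C'')"
      proof
        fix s assume s: "s \<in> \<Q> T \<inter> {..N}"
        show "s \<in> {..<x0} \<union> (A' + B' + C'')"
        proof (cases "s < x0")
          case False
          then have "s \<in> \<Q> T \<inter> {x0..}" using s by simp
          then have "s \<in> A + B + C'" using x0 by blast
          then obtain a b c where abc: "a \<in> A" "b \<in> B" "c \<in> C'" "s = a + b + c" by (auto simp: set_plus_def)
          moreover have "a \<noteq> 0" "b \<noteq> 0" "c \<noteq> 0" using abc zero by metis+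
          ultimately have "a \<in> A'" "b \<in> B'" "c \<in> C''" using s by (auto simp: A'_B'_C''_def)
          then show ?thesis using abc(4) by (auto intro!: set_plus_intro)
        qed simp
      qed
      then have "card (\<Q> T \<inter> {..N}) \<le> card ({..<x0} \<union> (A' + B' + C''))"
        using fin by (intro card_mono) (auto simp: finite_set_plus)
      also have "\<dots> \<le> x0 + card (A' + B' + C'')" using card_Un_le[of "{..<x0}"] by (metis card_lessThan)
      finally show ?thesis .
    qed
    ultimately have "real (card (\<Q> T \<inter> {..N})) \<le> real x0 + real (2 * N) powr (39 / 40)" by linarith
    then show False using elim(2,3) by linarith
  qed
  then show False by simp
qed

end
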